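(* Let $S$ be a closed oriented surface of genus at least $2$, let $h,h^\star$ be two hyperbolic metrics on $S$, let $b$ be the associated bundle morphism, and for $\theta\in\mathbb R$ let $\beta_\theta=\cos(\theta/2)E+\sin(\theta/2)Jb$. Then for all $\theta\in\mathbb R$, $h(\beta_\theta\cdot,\beta_\theta\cdot)$ is a hyperbolic metric on $S$.
   Context: "Hyperbolic metric" means smooth Riemannian metric of constant curvature $-1$. For two hyperbolic metrics $h,h^\star$ on $S$, the associated bundle morphism $b:TS\to TS$ is the unique one which is positive-definite and self-adjoint for $h$, has determinant $1$ everywhere, satisfies the Codazzi equation $d^\nabla b=0$, i.e. $\nabla_u(bv)-\nabla_v(bu)-b[u,v]=0$ for all vector fields $u,v$ (where $\nabla$ is the Levi-Civita connection of $h$), and is such that the metric $h(b\cdot,b\cdot)$ is isotopic to $h^\star$. (Its existence and uniqueness is a known result.) $E:TS\to TS$ is the identity and $J$ is the complex structure of $h$ on $S$ (rotation by $+\pi/2$). *)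

theory Defs
  imports "HOL-Analysis.Analysis" "HOL-Homology.Homology"
begin

section \<open>Smooth functions on open subsets of Euclidean spaces\<close>

primrec Ck_on :: "nat \<Rightarrow> 'e::euclidean_space set \<Rightarrow> ('e \<Rightarrow> 'f::real_normed_vector) \<Rightarrow> bool" where
  "Ck_on 0 U f \<longleftrightarrow> continuous_on U f"
| "Ck_on (Suc k) U f \<longleftrightarrow>
     (\<forall>x\<in>U. f differentiable (at x)) \<and>
     (\<forall>e\<in>Basis. Ck_on k U (\<lambda>x. frechet_derivative f (at x) e))"

text \<open>Only used for open \<open>U\<close>.\<close>

definition smooth_on :: "'e::euclidean_space set \<Rightarrow> ('e \<Rightarrow> 'f::real_normed_vector) \<Rightarrow> bool" where
  "smooth_on U f \<longleftrightarrow> (\<forall>k. Ck_on k U f)"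


section \<open>Closed oriented surfaces\<close>

text \<open>A chart is a pair of its domain and its coordinate map; the values of the coordinate map off
  the domain are irrelevant.\<close>

type_synonym 'a chart = "'a set \<times> ('a \<Rightarrow> real^2)"

record 'a surface =
  surf_top :: "'a topology"
  charts :: "'a chart set"

abbreviation points :: "'a surface \<Rightarrow> 'a set" where
  "points S \<equiv> topspace (surf_top S)"

definition chart_inv :: "'a chart \<Rightarrow> real^2 \<Rightarrow> 'a" where
  "chart_inv c = inv_into (fst c) (snd c)"

definition transition :: "'a chart \<Rightarrow> 'a chart \<Rightarrow> real^2 \<Rightarrow> real^2" where
  "transition c d = snd d \<circ> chart_inv c"

definition is_chart :: "'a topology \<Rightarrow> 'a chart \<Rightarrow> bool" where
  "is_chart X c \<longleftrightarrow>
     openin X (fst c) \<and> open (snd c ` fst c) \<and>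
     homeomorphic_map (subtopology X (fst c)) (top_of_set (snd c ` fst c)) (snd c)"

text \<open>The orientation is the one given by the charts, whose changes of coordinates all have positive
  Jacobian determinant. The atlas need not be maximal.\<close>

definition closed_oriented_surface :: "'a surface \<Rightarrow> bool" where
  "closed_oriented_surface S \<longleftrightarrow>
     Hausdorff_space (surf_top S) \<and> second_countable (surf_top S) \<and>
     compact_space (surf_top S) \<and> connected_space (surf_top S) \<and> points S \<noteq> {} \<and>
     (\<forall>c\<in>charts S. is_chart (surf_top S) c) \<and>
     (\<Union>c\<in>charts S. fst c) = points S \<and>
     (\<forall>c\<in>charts S. \<forall>d\<in>charts S.
        smooth_on (snd c ` (fst c \<inter> fst d)) (transition c d) \<and>
        (\<forall>x\<in>snd c ` (fst c \<inter> fst d).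
           det (matrix (frechet_derivative (transition c d) (at x))) > 0))"

text \<open>A closed oriented surface has genus \<open>g\<close> if its first integral homology group is free abelian
  of rank \<open>2 g\<close>.\<close>

definition has_genus :: "'a surface \<Rightarrow> nat \<Rightarrow> bool" where
  "has_genus S g \<longleftrightarrow> homology_group 1 (surf_top S) \<cong> free_Abelian_group {..<2 * g}"

definition chart_at :: "'a surface \<Rightarrow> 'a \<Rightarrow> 'a chart" where
  "chart_at S p = (SOME c. c \<in> charts S \<and> p \<in> fst c)"


section \<open>Tangent vectors\<close>

text \<open>A tangent vector at \<open>p\<close> is the family of its coordinate vectors in all charts around \<open>p\<close>, related
  by the derivatives of the changes of coordinates; its entry is 0 at all other indices. In
  particular the tangent space is \<open>{tzero}\<close> when \<open>p\<close> is not a point of \<open>S\<close>, so that vector fields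
  are automatically zero off \<open>S\<close>.\<close>

type_synonym 'a tvec = "'a chart \<Rightarrow> real^2"

definition tzero :: "'a tvec" where
  "tzero = (\<lambda>c. 0)"

definition lincomb :: "real \<Rightarrow> 'a tvec \<Rightarrow> real \<Rightarrow> 'a tvec \<Rightarrow> 'a tvec" where
  "lincomb a u b v = (\<lambda>c. a *\<^sub>R u c + b *\<^sub>R v c)"

definition tangent_space :: "'a surface \<Rightarrow> 'a \<Rightarrow> 'a tvec set" where
  "tangent_space S p =
     {v. (\<forall>c. \<not> (c \<in> charts S \<and> p \<in> fst c) \<longrightarrow> v c = 0) \<and>
         (\<forall>c\<in>charts S. \<forall>d\<in>charts S. p \<in> fst c \<and> p \<in> fst d \<longrightarrow>
            v d = frechet_derivative (transition c d) (at (snd c p)) (v c))}"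

text \<open>The tangent vector at \<open>p\<close> whose coordinate vector in the chart \<open>c\<close> is \<open>x\<close>.\<close>

definition tvec_of :: "'a surface \<Rightarrow> 'a \<Rightarrow> 'a chart \<Rightarrow> real^2 \<Rightarrow> 'a tvec" where
  "tvec_of S p c x =
     (\<lambda>d. if d \<in> charts S \<and> p \<in> fst d
          then frechet_derivative (transition c d) (at (snd c p)) x else 0)"

text \<open>\<open>(v, w)\<close> is a positively oriented basis of the tangent space at \<open>p\<close>.\<close>

definition positive_basis :: "'a surface \<Rightarrow> 'a \<Rightarrow> 'a tvec \<Rightarrow> 'a tvec \<Rightarrow> bool" where
  "positive_basis S p v w \<longleftrightarrow>
     (\<forall>c\<in>charts S. p \<in> fst c \<longrightarrow> det (vector [v c, w c] :: real^2^2) > 0)"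


section \<open>Smooth maps and isotopies\<close>

definition smooth_fun :: "'a surface \<Rightarrow> ('a \<Rightarrow> real) \<Rightarrow> bool" where
  "smooth_fun S f \<longleftrightarrow> (\<forall>c\<in>charts S. smooth_on (snd c ` fst c) (f \<circ> chart_inv c))"

definition smooth_map :: "'a surface \<Rightarrow> ('a \<Rightarrow> 'a) \<Rightarrow> bool" where
  "smooth_map S f \<longleftrightarrow>
     continuous_map (surf_top S) (surf_top S) f \<and>
     (\<forall>c\<in>charts S. \<forall>d\<in>charts S.
        smooth_on (snd c ` {p \<in> fst c. f p \<in> fst d}) (snd d \<circ> f \<circ> chart_inv c))"

definition diffeomorphism :: "'a surface \<Rightarrow> ('a \<Rightarrow> 'a) \<Rightarrow> bool" where
  "diffeomorphism S f \<longleftrightarrow>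
     bij_betw f (points S) (points S) \<and> smooth_map S f \<and>
     smooth_map S (inv_into (points S) f)"

text \<open>The value of the differential does not depend on the chart around \<open>p\<close> used to compute it.\<close>

definition tangent_map :: "'a surface \<Rightarrow> ('a \<Rightarrow> 'a) \<Rightarrow> 'a \<Rightarrow> 'a tvec \<Rightarrow> 'a tvec" where
  "tangent_map S f p v =
     (\<lambda>d. if d \<in> charts S \<and> f p \<in> fst d
          then let c = chart_at S p in
            frechet_derivative (snd d \<circ> f \<circ> chart_inv c) (at (snd c p)) (v c)
          else 0)"

text \<open>Smoothness on \<open>[0,1] \<times> S\<close> means the existence of a smooth extension to \<open>I \<times> S\<close> for an open
  \<open>I\<close> containing \<open>[0,1]\<close>.\<close>

definition isotopic_to_id :: "'a surface \<Rightarrow> ('a \<Rightarrow> 'a) \<Rightarrow> bool" where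
  "isotopic_to_id S f \<longleftrightarrow>
     (\<exists>I F. open I \<and> {0..1::real} \<subseteq> I \<and>
        continuous_map (prod_topology (top_of_set I) (surf_top S)) (surf_top S) (\<lambda>(t, p). F t p) \<and>
        (\<forall>c\<in>charts S. \<forall>d\<in>charts S.
           smooth_on {(t, x). t \<in> I \<and> x \<in> snd c ` fst c \<and> F t (chart_inv c x) \<in> fst d}
             (\<lambda>(t, x). snd d (F t (chart_inv c x)))) \<and>
        (\<forall>t\<in>{0..1}. diffeomorphism S (F t)) \<and>
        (\<forall>p\<in>points S. F 0 p = p) \<and>
        (\<forall>p\<in>points S. F 1 p = f p))"


section \<open>Vector fields, metrics and bundle morphisms\<close>

type_synonym 'a vfield = "'a \<Rightarrow> 'a tvec"
type_synonym 'a metric_field = "'a \<Rightarrow> 'a tvec \<Rightarrow> 'a tvec \<Rightarrow> real"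
type_synonym 'a morphism = "'a \<Rightarrow> 'a tvec \<Rightarrow> 'a tvec"

definition vector_field :: "'a surface \<Rightarrow> 'a vfield \<Rightarrow> bool" where
  "vector_field S u \<longleftrightarrow>
     (\<forall>p. u p \<in> tangent_space S p) \<and>
     (\<forall>c\<in>charts S. smooth_on (snd c ` fst c) (\<lambda>x. u (chart_inv c x) c))"

definition riemannian_metric :: "'a surface \<Rightarrow> 'a metric_field \<Rightarrow> bool" where
  "riemannian_metric S h \<longleftrightarrow>
     (\<forall>p\<in>points S. \<forall>u\<in>tangent_space S p. \<forall>v\<in>tangent_space S p.
        h p u v = h p v u \<and>
        (\<forall>w\<in>tangent_space S p. \<forall>a b. h p (lincomb a u b v) w = a * h p u w + b * h p v w) \<and>
        (u \<noteq> tzero \<longrightarrow> h p u u > 0)) \<and>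
     (\<forall>c\<in>charts S. \<forall>i j. smooth_on (snd c ` fst c)
        (\<lambda>x. h (chart_inv c x) (tvec_of S (chart_inv c x) c (axis i 1))
                               (tvec_of S (chart_inv c x) c (axis j 1))))"

text \<open>A smooth morphism from the tangent bundle to itself, over the identity. Off \<open>S\<close> it is only
  required to fix the zero vector.\<close>

definition bundle_morphism :: "'a surface \<Rightarrow> 'a morphism \<Rightarrow> bool" where
  "bundle_morphism S b \<longleftrightarrow>
     (\<forall>p. \<forall>u\<in>tangent_space S p. \<forall>v\<in>tangent_space S p.
        b p u \<in> tangent_space S p \<and>
        (\<forall>r s. b p (lincomb r u s v) = lincomb r (b p u) s (b p v))) \<and>
     (\<forall>c\<in>charts S. \<forall>i. smooth_on (snd c ` fst c)
        (\<lambda>x. b (chart_inv c x) (tvec_of S (chart_inv c x) c (axis i 1)) c))"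

text \<open>Determinant at \<open>p\<close> of a bundle morphism, computed in a chart around \<open>p\<close> (any chart gives the
  same value).\<close>

definition morphism_det :: "'a surface \<Rightarrow> 'a morphism \<Rightarrow> 'a \<Rightarrow> real" where
  "morphism_det S b p =
     (let c = chart_at S p in det (matrix (\<lambda>x. b p (tvec_of S p c x) c)))"

text \<open>The metric \<open>h(b\<cdot>, b\<cdot>)\<close>.\<close>

definition metric_via :: "'a metric_field \<Rightarrow> 'a morphism \<Rightarrow> 'a metric_field" where
  "metric_via h b = (\<lambda>p u v. h p (b p u) (b p v))"

definition isotopic_metrics :: "'a surface \<Rightarrow> 'a metric_field \<Rightarrow> 'a metric_field \<Rightarrow> bool" where
  "isotopic_metrics S h k \<longleftrightarrow>
     (\<exists>f. isotopic_to_id S f \<and>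
        (\<forall>p\<in>points S. \<forall>u\<in>tangent_space S p. \<forall>v\<in>tangent_space S p.
           h p u v = k (f p) (tangent_map S f p u) (tangent_map S f p v)))"


section \<open>Levi-Civita connection and curvature\<close>

text \<open>Derivative of the function \<open>f\<close> along the tangent vector \<open>v\<close> at \<open>p\<close>.\<close>

definition dir_deriv :: "'a surface \<Rightarrow> 'a \<Rightarrow> 'a tvec \<Rightarrow> ('a \<Rightarrow> real) \<Rightarrow> real" where
  "dir_deriv S p v f =
     (let c = chart_at S p in frechet_derivative (f \<circ> chart_inv c) (at (snd c p)) (v c))"

text \<open>In coordinates, \<open>[u,v] = D v(u) - D u(v)\<close>.\<close>

definition lie_bracket :: "'a surface \<Rightarrow> 'a vfield \<Rightarrow> 'a vfield \<Rightarrow> 'a vfield" where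
  "lie_bracket S u v =
     (\<lambda>p c. if c \<in> charts S \<and> p \<in> fst c
            then frechet_derivative (\<lambda>x. v (chart_inv c x) c) (at (snd c p)) (u p c)
               - frechet_derivative (\<lambda>x. u (chart_inv c x) c) (at (snd c p)) (v p c)
            else 0)"

text \<open>\<open>D u v\<close> stands for \<open>\<nabla>\<^sub>u v\<close>.\<close>

type_synonym 'a connection = "'a vfield \<Rightarrow> 'a vfield \<Rightarrow> 'a vfield"

definition affine_connection :: "'a surface \<Rightarrow> 'a connection \<Rightarrow> bool" where
  "affine_connection S D \<longleftrightarrow>
     (\<forall>u v w f g. vector_field S u \<and> vector_field S v \<and> vector_field S w \<and>
                  smooth_fun S f \<and> smooth_fun S g \<longrightarrow>
        vector_field S (D u v) \<and>
        D (\<lambda>p. lincomb (f p) (u p) (g p) (v p)) w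
          = (\<lambda>p. lincomb (f p) (D u w p) (g p) (D v w p)) \<and>
        D u (\<lambda>p. lincomb 1 (v p) 1 (w p)) = (\<lambda>p. lincomb 1 (D u v p) 1 (D u w p)) \<and>
        D u (\<lambda>p c. f p *\<^sub>R v p c)
          = (\<lambda>p. lincomb (dir_deriv S p (u p) f) (v p) (f p) (D u v p)))"

definition levi_civita :: "'a surface \<Rightarrow> 'a metric_field \<Rightarrow> 'a connection \<Rightarrow> bool" where
  "levi_civita S h D \<longleftrightarrow>
     affine_connection S D \<and>
     (\<forall>u v. vector_field S u \<and> vector_field S v \<longrightarrow>
        (\<lambda>p. lincomb 1 (D u v p) (-1) (D v u p)) = lie_bracket S u v) \<and>
     (\<forall>u v w. vector_field S u \<and> vector_field S v \<and> vector_field S w \<longrightarrow>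
        (\<forall>p\<in>points S. dir_deriv S p (u p) (\<lambda>q. h q (v q) (w q))
           = h p (D u v p) (w p) + h p (v p) (D u w p)))"

text \<open>\<open>R(u,v)w = \<nabla>\<^sub>u \<nabla>\<^sub>v w - \<nabla>\<^sub>v \<nabla>\<^sub>u w - \<nabla>\<^bsub>[u,v]\<^esub> w\<close>\<close>

definition curvature_tensor ::
  "'a surface \<Rightarrow> 'a connection \<Rightarrow> 'a vfield \<Rightarrow> 'a vfield \<Rightarrow> 'a vfield \<Rightarrow> 'a vfield" where
  "curvature_tensor S D u v w =
     (\<lambda>p c. D u (D v w) p c - D v (D u w) p c - D (lie_bracket S u v) w p c)"

text \<open>The Levi-Civita connection exists and is unique, so the choice of quantifier for it is
  immaterial here and in the Codazzi equation. The equation is the one for the sectional (that is, on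
  a surface, Gaussian) curvature, with the denominator cleared.\<close>

definition constant_curvature :: "'a surface \<Rightarrow> 'a metric_field \<Rightarrow> real \<Rightarrow> bool" where
  "constant_curvature S h K \<longleftrightarrow>
     (\<exists>D. levi_civita S h D \<and>
        (\<forall>u v. vector_field S u \<and> vector_field S v \<longrightarrow>
           (\<forall>p\<in>points S. h p (curvature_tensor S D u v v p) (u p)
              = K * (h p (u p) (u p) * h p (v p) (v p) - (h p (u p) (v p))\<^sup>2))))"

definition hyperbolic_metric :: "'a surface \<Rightarrow> 'a metric_field \<Rightarrow> bool" where
  "hyperbolic_metric S h \<longleftrightarrow> riemannian_metric S h \<and> constant_curvature S h (-1)"


section \<open>The morphisms of the statement\<close>

text \<open>\<open>\<nabla>\<^sub>u(bv) - \<nabla>\<^sub>v(bu) - b[u,v] = 0\<close>\<close>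

definition codazzi :: "'a surface \<Rightarrow> 'a metric_field \<Rightarrow> 'a morphism \<Rightarrow> bool" where
  "codazzi S h b \<longleftrightarrow>
     (\<exists>D. levi_civita S h D \<and>
        (\<forall>u v. vector_field S u \<and> vector_field S v \<longrightarrow>
           (\<forall>p\<in>points S. \<forall>c.
              D u (\<lambda>q. b q (v q)) p c - D v (\<lambda>q. b q (u q)) p c - b p (lie_bracket S u v p) c = 0)))"

definition associated_morphism ::
  "'a surface \<Rightarrow> 'a metric_field \<Rightarrow> 'a metric_field \<Rightarrow> 'a morphism \<Rightarrow> bool" where
  "associated_morphism S h hstar b \<longleftrightarrow>
     bundle_morphism S b \<and>
     (\<forall>p\<in>points S. \<forall>u\<in>tangent_space S p. \<forall>v\<in>tangent_space S p. h p (b p u) v = h p u (b p v)) \<and>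
     (\<forall>p\<in>points S. \<forall>u\<in>tangent_space S p. u \<noteq> tzero \<longrightarrow> h p (b p u) u > 0) \<and>
     (\<forall>p\<in>points S. morphism_det S b p = 1) \<and>
     codazzi S h b \<and>
     isotopic_metrics S (metric_via h b) hstar"

text \<open>\<open>J\<close>: rotation by \<open>+\<pi>/2\<close> for the metric \<open>h\<close> and the orientation of \<open>S\<close>.\<close>

definition complex_structure :: "'a surface \<Rightarrow> 'a metric_field \<Rightarrow> 'a morphism" where
  "complex_structure S h p v =
     (THE w. w \<in> tangent_space S p \<and> h p v w = 0 \<and> h p w w = h p v v \<and>
             (v \<noteq> tzero \<longrightarrow> positive_basis S p v w))"

definition beta :: "'a surface \<Rightarrow> 'a metric_field \<Rightarrow> 'a morphism \<Rightarrow> real \<Rightarrow> 'a morphism" where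
  "beta S h b \<theta> =
     (\<lambda>p v. lincomb (cos (\<theta> / 2)) v (sin (\<theta> / 2)) (complex_structure S h p (b p v)))"

end

theory Submission
  imports Defs
begin

text \<open>Put \<open>K = J b\<close>. As \<open>b\<close> is self-adjoint with determinant 1, \<open>K\<close> has trace 0 and determinant 1, so
  \<open>K\<^sup>2 = -E\<close>, and \<open>\<beta>\<^bsub>\<theta>\<^esub> = cos (\<theta>/2) E + sin (\<theta>/2) K\<close> has determinant 1 and inverse
  \<open>\<beta>\<^bsub>-\<theta>\<^esub>\<close>. Since \<open>\<nabla>J = 0\<close>, \<open>\<beta>\<^bsub>\<theta>\<^esub>\<close> inherits the Codazzi equation from \<open>E\<close> and \<open>b\<close>; this
  equation says exactly that the metric connection \<open>\<beta>\<^sup>-\<^sup>1 \<nabla> \<beta>\<close> of \<open>h(\<beta>\<cdot>, \<beta>\<cdot>)\<close> is torsion-free. So it is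
  the Levi-Civita connection, its curvature tensor is \<open>\<beta>\<^sup>-\<^sup>1 R \<beta>\<close>, and the Gaussian curvature gets divided
  by \<open>det \<beta> = 1\<close>.\<close>

text \<open>The trace of \<open>K\<close> vanishes because the adjoint of \<open>J b\<close> is -b
  J, which has the opposite trace; hence the determinant of c E + s K has no term linear in s. The
  curvature is divided by only one power of the determinant because h(R(u,v)Bv, Bu) is a mixed Gram
  determinant of the pairs (u, v) and (Bu, Bv), with one factor det B, whereas the squared area of
  the new metric carries two. The obstacle is that a connection acts on global vector fields, so
  that the value of a covariant derivative or of a curvature expression at a point is not known in
  advance to depend only on vectors at that point. Pointwise statements are extracted from metric
  identities between fields instead: skewness, nondegeneracy, and adding a second field where
  vectors vanish or are parallel. Moreover the Codazzi equation and the curvature equation each come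
  with a Levi-Civita connection of their own, so uniqueness has to identify the two.\<close>

section \<open>Smooth functions\<close>

text \<open>The derivative at a point of \<open>U\<close> sees only a neighbourhood, and
  \<open>U\<close> is open, so agreement on \<open>U\<close> passes to derivatives of every
  order.\<close>

lemma Ck_on_cong:
  assumes "open U" "\<And>x. x \<in> U \<Longrightarrow> f x = g x"
  shows "Ck_on k U f \<longleftrightarrow> Ck_on k U g"
proof -
  \<comment> \<open>Stated for all pairs: the induction replaces \<open>f\<close> and
    \<open>g\<close> by their partial derivatives, and the converse is the same claim with the two
    exchanged.\<close>
  have imp: "Ck_on k U g" if "Ck_on k U f" "\<And>x. x \<in> U \<Longrightarrow> f x = g x"
    for f g :: "'a \<Rightarrow> 'b"
    using that
  proof (induction k arbitrary: f g)
    case 0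
    then show ?case by (simp cong: continuous_on_cong)
  next
    case (Suc k)
    have hd: "(g has_derivative frechet_derivative f (at x)) (at x)" if "x \<in> U" for x
    proof (rule has_derivative_transform_within_open[OF _ \<open>open U\<close> that])
      show "(f has_derivative frechet_derivative f (at x)) (at x)"
        using Suc.prems that by (simp add: frechet_derivative_works)
    qed (use Suc.prems in auto)
    show ?case
      using Suc.prems hd Suc.IH
      by (auto simp: frechet_derivative_at[OF hd, symmetric] differentiable_def)
  qed
  show ?thesis
    using assms imp[of f g] imp[of g f] by auto
qed

lemma smooth_on_cong:
  assumes "open U" "\<And>x. x \<in> U \<Longrightarrow> f x = g x"
  shows "smooth_on U f \<longleftrightarrow> smooth_on U g"
proof -
  have "Ck_on k U f \<longleftrightarrow> Ck_on k U g" for k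
    by (rule Ck_on_cong[of U f g k, OF assms])
  then show ?thesis unfolding smooth_on_def by simp
qed

lemma smooth_on_transform:
  assumes "smooth_on U g" "open U" "\<And>x. x \<in> U \<Longrightarrow> f x = g x"
  shows "smooth_on U f"
  using smooth_on_cong[of U f g, OF assms(2,3)] assms(1) by simp

text \<open>Lets the inductions below work with an explicit derivative formula in place of the
  choice hidden in \<open>frechet_derivative\<close>.\<close>

lemma Ck_on_SucI:
  assumes "open U"
    and "\<And>x. x \<in> U \<Longrightarrow> (f has_derivative f' x) (at x)"
    and "\<And>e. e \<in> Basis \<Longrightarrow> Ck_on k U (\<lambda>x. f' x e)"
  shows "Ck_on (Suc k) U f"
proof -
  have "Ck_on k U (\<lambda>x. frechet_derivative f (at x) e)" if "e \<in> Basis" for e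
  proof (rule iffD1[OF Ck_on_cong[OF \<open>open U\<close>] assms(3)[OF that]])
    show "f' x e = frechet_derivative f (at x) e" if "x \<in> U" for x
      using frechet_derivative_at[OF assms(2)[OF that]] by simp
  qed
  then show ?thesis
    using assms(2) by (auto simp: differentiable_def)
qed

lemma Ck_on_Suc_hasD:
  "Ck_on (Suc k) U f \<Longrightarrow> x \<in> U \<Longrightarrow> (f has_derivative frechet_derivative f (at x)) (at x)"
  by (simp add: frechet_derivative_works)

lemma Ck_on_SucD: "Ck_on (Suc k) U f \<Longrightarrow> Ck_on k U f"
proof (induction k arbitrary: f)
  case 0
  then show ?case
    by (auto intro!: continuous_at_imp_continuous_on differentiable_imp_continuous_within)
qed auto

lemma Ck_on_const: "Ck_on k U (\<lambda>x. c)"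
  by (induction k arbitrary: c) auto

lemma Ck_on_bounded_linear:
  assumes "bounded_linear L" "open U" "Ck_on k U f"
  shows "Ck_on k U (\<lambda>x. L (f x))"
  using assms(3)
proof (induction k arbitrary: f)
  case 0
  then show ?case
    by (simp add: bounded_linear.continuous_on[OF assms(1)])
next
  case (Suc k)
  show ?case
  proof (rule Ck_on_SucI[OF \<open>open U\<close>])
    show "((\<lambda>x. L (f x)) has_derivative (\<lambda>e. L (frechet_derivative f (at x) e))) (at x)"
      if "x \<in> U" for x
      using bounded_linear.has_derivative[OF assms(1) Ck_on_Suc_hasD[OF Suc.prems that]] .
  qed (use Suc in auto)
qed

lemma Ck_on_add:
  assumes "open U" "Ck_on k U f" "Ck_on k U g"
  shows "Ck_on k U (\<lambda>x. f x + g x)"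
  using assms(2,3)
proof (induction k arbitrary: f g)
  case 0
  then show ?case by (auto intro: continuous_on_add)
next
  case (Suc k)
  show ?case
  proof (rule Ck_on_SucI[OF \<open>open U\<close>])
    show "((\<lambda>x. f x + g x) has_derivative
        (\<lambda>e. frechet_derivative f (at x) e + frechet_derivative g (at x) e)) (at x)"
      if "x \<in> U" for x
      using Suc.prems that by (intro has_derivative_add Ck_on_Suc_hasD)
  qed (use Suc in auto)
qed

lemma Ck_on_bounded_bilinear:
  assumes "bounded_bilinear B" "open U" "Ck_on k U f" "Ck_on k U g"
  shows "Ck_on k U (\<lambda>x. B (f x) (g x))"
  using assms(3,4)
proof (induction k arbitrary: f g)
  case 0
  then show ?case
    by (simp add: bounded_bilinear.continuous_on[OF assms(1)])
next
  case (Suc k)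
  show ?case
  proof (rule Ck_on_SucI[OF \<open>open U\<close>])
    show "((\<lambda>x. B (f x) (g x)) has_derivative
        (\<lambda>e. B (f x) (frechet_derivative g (at x) e) + B (frechet_derivative f (at x) e) (g x))) (at x)"
      if "x \<in> U" for x
      using bounded_bilinear.FDERIV[OF assms(1) Ck_on_Suc_hasD[OF Suc.prems(1) that]
          Ck_on_Suc_hasD[OF Suc.prems(2) that]] .
    show "Ck_on k U (\<lambda>x. B (f x) (frechet_derivative g (at x) e)
        + B (frechet_derivative f (at x) e) (g x))" if "e \<in> Basis" for e
      using Suc.prems that
      by (intro Ck_on_add[OF \<open>open U\<close>] Suc.IH Ck_on_SucD[OF Suc.prems(1)] Ck_on_SucD[OF Suc.prems(2)]) auto
  qed
qed

lemmas Ck_on_mult = Ck_on_bounded_bilinear[OF bounded_bilinear_mult]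
lemmas Ck_on_scaleR = Ck_on_bounded_bilinear[OF bounded_bilinear_scaleR]

text \<open>The derivative of 1/f is a product of two copies of 1/f and a derivative of f, so order
  k of 1/f itself, the induction hypothesis, yields the next order.\<close>

lemma Ck_on_inverse:
  fixes f :: "'e::euclidean_space \<Rightarrow> real"
  assumes "open U" "Ck_on k U f" "\<And>x. x \<in> U \<Longrightarrow> f x \<noteq> 0"
  shows "Ck_on k U (\<lambda>x. inverse (f x))"
  using assms(2)
proof (induction k)
  case 0
  then show ?case using assms(3) by (auto intro: continuous_on_inverse)
next
  case (Suc k)
  have inv: "Ck_on k U (\<lambda>x. inverse (f x))" by (rule Suc.IH[OF Ck_on_SucD[OF Suc.prems]])
  show ?case
  proof (rule Ck_on_SucI[OF \<open>open U\<close>])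
    show "((\<lambda>x. inverse (f x)) has_derivative
        (\<lambda>e. - 1 * (inverse (f x) * frechet_derivative f (at x) e * inverse (f x)))) (at x)"
      if "x \<in> U" for x
      using Deriv.has_derivative_inverse[OF assms(3)[OF that] Ck_on_Suc_hasD[OF Suc.prems that]] by simp
    show "Ck_on k U (\<lambda>x. - 1 * (inverse (f x) * frechet_derivative f (at x) e * inverse (f x)))"
      if "e \<in> Basis" for e
      using Suc.prems that by (intro Ck_on_mult[OF \<open>open U\<close>] inv Ck_on_const) auto
  qed
qed

text \<open>Same bootstrapping as for the inverse: the derivative is f'/(2 sqrt f), and order k of
  sqrt f gives order k of its reciprocal.\<close>

lemma Ck_on_sqrt:
  fixes f :: "'e::euclidean_space \<Rightarrow> real"
  assumes "open U" "Ck_on k U f" "\<And>x. x \<in> U \<Longrightarrow> f x > 0"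
  shows "Ck_on k U (\<lambda>x. sqrt (f x))"
  using assms(2)
proof (induction k)
  case 0
  then show ?case by (auto intro: continuous_on_real_sqrt)
next
  case (Suc k)
  have pos: "sqrt (f x) \<noteq> 0" if "x \<in> U" for x
    using assms(3)[OF that] by simp
  have inv: "Ck_on k U (\<lambda>x. inverse (sqrt (f x)))"
    by (rule Ck_on_inverse[OF \<open>open U\<close> Suc.IH[OF Ck_on_SucD[OF Suc.prems]] pos])
  show ?case
  proof (rule Ck_on_SucI[OF \<open>open U\<close>])
    show "((\<lambda>x. sqrt (f x)) has_derivative
        (\<lambda>e. frechet_derivative f (at x) e * (inverse (sqrt (f x)) * (1 / 2)))) (at x)"
      if "x \<in> U" for x
      using has_derivative_real_sqrt[OF assms(3)[OF that] Ck_on_Suc_hasD[OF Suc.prems that]] 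
      by (simp add: field_simps)
    show "Ck_on k U (\<lambda>x. frechet_derivative f (at x) e * (inverse (sqrt (f x)) * (1 / 2)))"
      if "e \<in> Basis" for e
      using Suc.prems that by (intro Ck_on_mult[OF \<open>open U\<close>] inv Ck_on_const) auto
  qed
qed

lemma smooth_on_const: "smooth_on U (\<lambda>x. c)"
  by (simp add: smooth_on_def Ck_on_const)

lemma smooth_on_add:
  "open U \<Longrightarrow> smooth_on U f \<Longrightarrow> smooth_on U g \<Longrightarrow> smooth_on U (\<lambda>x. f x + g x)"
  by (simp add: smooth_on_def Ck_on_add)

lemma smooth_on_mult:
  fixes f g :: "'e::euclidean_space \<Rightarrow> real"
  shows "open U \<Longrightarrow> smooth_on U f \<Longrightarrow> smooth_on U g \<Longrightarrow> smooth_on U (\<lambda>x. f x * g x)"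
  by (simp add: smooth_on_def Ck_on_mult)

lemma smooth_on_diff:
  fixes f g :: "'e::euclidean_space \<Rightarrow> 'f::real_normed_vector"
  assumes "open U" "smooth_on U f" "smooth_on U g"
  shows "smooth_on U (\<lambda>x. f x - g x)"
proof -
  have "Ck_on k U (\<lambda>x. f x + - g x)" for k
    using assms Ck_on_bounded_linear[OF bounded_linear_minus[OF bounded_linear_ident], of U k g]
    by (intro Ck_on_add) (auto simp: smooth_on_def)
  then show ?thesis by (simp add: smooth_on_def)
qed

lemma smooth_on_scaleR:
  "open U \<Longrightarrow> smooth_on U f \<Longrightarrow> smooth_on U g \<Longrightarrow> smooth_on U (\<lambda>x. f x *\<^sub>R g x)"
  by (simp add: smooth_on_def Ck_on_scaleR)

lemma smooth_on_component:
  fixes f :: "'e::euclidean_space \<Rightarrow> real^'n"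
  shows "open U \<Longrightarrow> smooth_on U f \<Longrightarrow> smooth_on U (\<lambda>x. f x $ i)"
  by (simp add: smooth_on_def Ck_on_bounded_linear[OF bounded_linear_vec_nth])

lemma smooth_on_inverse_sqrt:
  fixes f :: "'e::euclidean_space \<Rightarrow> real"
  shows "open U \<Longrightarrow> smooth_on U f \<Longrightarrow> (\<And>x. x \<in> U \<Longrightarrow> f x > 0) \<Longrightarrow> smooth_on U (\<lambda>x. inverse (sqrt (f x)))"
  unfolding smooth_on_def by (intro allI Ck_on_inverse Ck_on_sqrt) (auto simp: less_imp_neq[symmetric])

lemma smooth_on_differentiable:
  "smooth_on U f \<Longrightarrow> x \<in> U \<Longrightarrow> f differentiable (at x)"
  using Ck_on.simps(2) unfolding smooth_on_def by blast

lemma smooth_on_partial: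
  "smooth_on U f \<Longrightarrow> e \<in> Basis \<Longrightarrow> smooth_on U (\<lambda>x. frechet_derivative f (at x) e)"
  unfolding smooth_on_def using Ck_on.simps(2) by blast

lemma smooth_on_continuous_on: "smooth_on U f \<Longrightarrow> continuous_on U f"
  unfolding smooth_on_def using Ck_on.simps(1) by blast

section \<open>Symmetry of second partial derivatives\<close>

lemma DERIV_along_line:
  fixes f :: "'e::euclidean_space \<Rightarrow> real"
  assumes "f differentiable (at (y + t *\<^sub>R d))"
  shows "((\<lambda>t. f (y + t *\<^sub>R d)) has_real_derivative frechet_derivative f (at (y + t *\<^sub>R d)) d) (at t)"
proof -
  have "((\<lambda>t. y + t *\<^sub>R d) has_derivative (\<lambda>s. s *\<^sub>R d)) (at t)"
    by (auto intro!: derivative_eq_intros)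
  from has_derivative_compose[OF this assms[unfolded frechet_derivative_works]]
  have "((\<lambda>t. f (y + t *\<^sub>R d)) has_derivative
      (\<lambda>s. frechet_derivative f (at (y + t *\<^sub>R d)) (s *\<^sub>R d))) (at t)" .
  moreover have "(\<lambda>s. frechet_derivative f (at (y + t *\<^sub>R d)) (s *\<^sub>R d))
      = (*) (frechet_derivative f (at (y + t *\<^sub>R d)) d)"
    by (rule ext) (simp add: linear_cmul[OF linear_frechet_derivative[OF assms]])
  ultimately show ?thesis
    by (simp add: has_field_derivative_def)
qed

text \<open>The mean value theorem is used twice: for the increment in direction \<open>e\<close> as
  a function of the step along \<open>d\<close>, then for the \<open>d\<close>-derivative along
  \<open>e\<close>. The left side is symmetric in \<open>d\<close> and \<open>e\<close> while the
  right side fixes an order of differentiation, which is what the next lemma exploits.\<close>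

lemma double_difference:
  fixes f :: "'e::euclidean_space \<Rightarrow> real"
  assumes ball: "\<And>r t. 0 \<le> r \<Longrightarrow> r \<le> s \<Longrightarrow> 0 \<le> t \<Longrightarrow> t \<le> s \<Longrightarrow> x + r *\<^sub>R d + t *\<^sub>R e \<in> U"
    and f: "\<And>y. y \<in> U \<Longrightarrow> f differentiable (at y)"
    and fd: "\<And>y. y \<in> U \<Longrightarrow> (\<lambda>y. frechet_derivative f (at y) d) differentiable (at y)"
    and s: "0 < s"
  shows "\<exists>r t. 0 \<le> r \<and> r \<le> s \<and> 0 \<le> t \<and> t \<le> s \<and>
    f (x + s *\<^sub>R d + s *\<^sub>R e) - f (x + s *\<^sub>R d) - f (x + s *\<^sub>R e) + f x =
    s\<^sup>2 * frechet_derivative (\<lambda>y. frechet_derivative f (at y) d) (at (x + r *\<^sub>R d + t *\<^sub>R e)) e"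
proof -
  let ?g = "\<lambda>y. frechet_derivative f (at y) d"
  let ?phi = "\<lambda>r. f ((x + s *\<^sub>R e) + r *\<^sub>R d) - f (x + r *\<^sub>R d)"
  have phi: "(?phi has_real_derivative (?g ((x + s *\<^sub>R e) + r *\<^sub>R d) - ?g (x + r *\<^sub>R d))) (at r)"
    if "0 \<le> r" "r \<le> s" for r
    using ball[OF that, of s] ball[OF that, of 0] s
    by (intro DERIV_diff DERIV_along_line f) (auto simp: add_ac)
  obtain r where r: "0 < r" "r < s"
    and 1: "?phi s - ?phi 0 = (s - 0) * (?g ((x + s *\<^sub>R e) + r *\<^sub>R d) - ?g (x + r *\<^sub>R d))"
    using MVT2[OF s phi] by auto
  have psi: "((\<lambda>t. ?g ((x + r *\<^sub>R d) + t *\<^sub>R e)) has_real_derivative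
      frechet_derivative ?g (at ((x + r *\<^sub>R d) + t *\<^sub>R e)) e) (at t)"
    if "0 \<le> t" "t \<le> s" for t
    using ball[OF _ _ that, of r] r by (intro DERIV_along_line fd) auto
  obtain t where t: "0 < t" "t < s"
    and 2: "?g ((x + r *\<^sub>R d) + s *\<^sub>R e) - ?g ((x + r *\<^sub>R d) + 0 *\<^sub>R e)
      = (s - 0) * frechet_derivative ?g (at ((x + r *\<^sub>R d) + t *\<^sub>R e)) e"
    using MVT2[OF s psi] by auto
  show ?thesis
    using r t 1 2 by (intro exI[of _ r] exI[of _ t]) (simp add: add_ac power2_eq_square)
qed

text \<open>Arbitrarily near \<open>x\<close>, each mixed partial takes as a value the same second
  difference divided by s^2; continuity carries the agreement to \<open>x\<close>.\<close>

lemma mixed_partials_commute: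
  fixes f :: "'e::euclidean_space \<Rightarrow> real"
  assumes "open U" "x \<in> U" "smooth_on U f" "d \<in> Basis" "e \<in> Basis"
  shows "frechet_derivative (\<lambda>y. frechet_derivative f (at y) d) (at x) e
       = frechet_derivative (\<lambda>y. frechet_derivative f (at y) e) (at x) d" (is "?A x = ?B x")
proof (rule ccontr)
  assume ne: "?A x \<noteq> ?B x"
  \<comment> \<open>Half the gap: a number within \<epsilon> of \<open>?A x\<close> cannot also be
    within \<epsilon> of \<open>?B x\<close>.\<close>
  define \<epsilon> where "\<epsilon> = \<bar>?A x - ?B x\<bar> / 2"
  have eps: "\<epsilon> > 0" using ne by (simp add: \<epsilon>_def)
  have cont: "isCont ?A x" "isCont ?B x"
    using assms
    by (auto simp: continuous_on_eq_continuous_at[symmetric] intro!: smooth_on_continuous_on smooth_on_partial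
        continuous_on_interior[of U] simp: interior_open)
  obtain d1 where d1: "d1 > 0" "\<And>y. dist y x < d1 \<Longrightarrow> \<bar>?A y - ?A x\<bar> < \<epsilon>"
    using cont(1) eps unfolding continuous_at_eps_delta dist_real_def by blast
  obtain d2 where d2: "d2 > 0" "\<And>y. dist y x < d2 \<Longrightarrow> \<bar>?B y - ?B x\<bar> < \<epsilon>"
    using cont(2) eps unfolding continuous_at_eps_delta dist_real_def by blast
  obtain d3 where d3: "d3 > 0" "ball x d3 \<subseteq> U"
    using assms(1,2) open_contains_ball by blast
  \<comment> \<open>The sampled points take at most a step s along each of two unit vectors, hence
    lie within 2 s of \<open>x\<close>; dividing by 3 keeps 2 s below all three radii.\<close>
  define s where "s = min d1 (min d2 d3) / 3"
  have s: "s > 0" "2 * s < d1" "2 * s < d2" "2 * s < d3"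
    using d1 d2 d3 by (auto simp: s_def)
  have near: "dist (x + r *\<^sub>R a + t *\<^sub>R b) x \<le> 2 * s"
    if "0 \<le> r" "r \<le> s" "0 \<le> t" "t \<le> s" "a \<in> Basis" "b \<in> Basis" for r t and a b :: 'e
    using that norm_triangle_ineq[of "r *\<^sub>R a" "t *\<^sub>R b"] by (simp add: dist_norm)
  have in_U: "x + r *\<^sub>R a + t *\<^sub>R b \<in> U"
    if "0 \<le> r" "r \<le> s" "0 \<le> t" "t \<le> s" "a \<in> Basis" "b \<in> Basis" for r t and a b :: 'e
    using near[OF that] s d3 by (auto simp: subset_iff dist_commute)
  have diff: "y \<in> U \<Longrightarrow> f differentiable (at y)" for y
    using assms smooth_on_differentiable by blast
  have diff': "y \<in> U \<Longrightarrow> a \<in> Basis \<Longrightarrow> (\<lambda>y. frechet_derivative f (at y) a) differentiable (at y)" for y a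
    using assms smooth_on_differentiable smooth_on_partial by blast
  obtain r t where rt: "0 \<le> r" "r \<le> s" "0 \<le> t" "t \<le> s"
    and 1: "f (x + s *\<^sub>R d + s *\<^sub>R e) - f (x + s *\<^sub>R d) - f (x + s *\<^sub>R e) + f x
      = s\<^sup>2 * ?A (x + r *\<^sub>R d + t *\<^sub>R e)"
    using double_difference[of s x d e U f] in_U diff diff' s(1) assms(4,5) by blast
  obtain r' t' where rt': "0 \<le> r'" "r' \<le> s" "0 \<le> t'" "t' \<le> s"
    and 2: "f (x + s *\<^sub>R e + s *\<^sub>R d) - f (x + s *\<^sub>R e) - f (x + s *\<^sub>R d) + f x
      = s\<^sup>2 * ?B (x + r' *\<^sub>R e + t' *\<^sub>R d)"
    using double_difference[of s x e d U f] in_U diff diff' s(1) assms(4,5) by blast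
  have "s\<^sup>2 * ?A (x + r *\<^sub>R d + t *\<^sub>R e) = s\<^sup>2 * ?B (x + r' *\<^sub>R e + t' *\<^sub>R d)"
    unfolding 1[symmetric] 2[symmetric] by (simp add: algebra_simps)
  then have "?A (x + r *\<^sub>R d + t *\<^sub>R e) = ?B (x + r' *\<^sub>R e + t' *\<^sub>R d)"
    using s by simp
  moreover have "\<bar>?A (x + r *\<^sub>R d + t *\<^sub>R e) - ?A x\<bar> < \<epsilon>"
    using near[OF rt assms(4,5)] s by (intro d1) auto
  moreover have "\<bar>?B (x + r' *\<^sub>R e + t' *\<^sub>R d) - ?B x\<bar> < \<epsilon>"
    using near[OF rt' assms(5,4)] s by (intro d2) auto
  ultimately show False
    by (simp add: \<epsilon>_def abs_if split: if_splits)
qed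

text \<open>Product rule, arranged so that the derivative of the direction \<open>V\<close> and the
  Hessian of \<phi> stand apart: in a commutator only the former survives.\<close>

lemma has_derivative_coordinate_deriv:
  fixes \<phi> :: "real^2 \<Rightarrow> real" and V :: "real^2 \<Rightarrow> real^2"
  assumes U: "open U" "x \<in> U" and \<phi>: "smooth_on U \<phi>" and V: "smooth_on U V"
  shows "((\<lambda>y. frechet_derivative \<phi> (at y) (V y)) has_derivative
    (\<lambda>e. frechet_derivative \<phi> (at x) (frechet_derivative V (at x) e) +
      (\<Sum>i\<in>UNIV. V x $ i * frechet_derivative (\<lambda>y. frechet_derivative \<phi> (at y) (axis i 1)) (at x) e))) (at x)"
proof -
  let ?d = "\<lambda>i y. frechet_derivative \<phi> (at y) (axis i 1)"
  have split: "frechet_derivative \<phi> (at y) w = (\<Sum>i\<in>UNIV. w $ i * ?d i y)" if "y \<in> U" for y w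
  proof -
    interpret linear "frechet_derivative \<phi> (at y)"
      using smooth_on_differentiable[OF \<phi> that] by (rule linear_frechet_derivative)
    have "w = (\<Sum>i\<in>UNIV. w $ i *\<^sub>R axis i 1)"
      using basis_expansion[of w] by (simp add: scalar_mult_eq_scaleR)
    then have "frechet_derivative \<phi> (at y) w = frechet_derivative \<phi> (at y) (\<Sum>i\<in>UNIV. w $ i *\<^sub>R axis i 1)"
      by (rule arg_cong)
    also have "\<dots> = (\<Sum>i\<in>UNIV. w $ i * ?d i y)"
      by (simp only: sum scale real_scaleR_def)
    finally show ?thesis .
  qed
  have hV: "((\<lambda>y. V y $ i) has_derivative (\<lambda>e. frechet_derivative V (at x) e $ i)) (at x)" for i
    using smooth_on_differentiable[OF V U(2)]
    by (intro bounded_linear.has_derivative[OF bounded_linear_vec_nth]) (simp add: frechet_derivative_works)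
  have hd: "(?d i has_derivative frechet_derivative (?d i) (at x)) (at x)" for i
    using smooth_on_differentiable[OF smooth_on_partial[OF \<phi>] U(2), of "axis i 1"]
    by (simp add: frechet_derivative_works[symmetric])
  have "((\<lambda>y. \<Sum>i\<in>UNIV. V y $ i * ?d i y) has_derivative
      (\<lambda>e. \<Sum>i\<in>UNIV. V x $ i * frechet_derivative (?d i) (at x) e + frechet_derivative V (at x) e $ i * ?d i x)) (at x)"
    by (intro has_derivative_sum has_derivative_mult hV hd)
  moreover have "(\<lambda>e. \<Sum>i\<in>UNIV. V x $ i * frechet_derivative (?d i) (at x) e + frechet_derivative V (at x) e $ i * ?d i x)
     = (\<lambda>e. frechet_derivative \<phi> (at x) (frechet_derivative V (at x) e) +
      (\<Sum>i\<in>UNIV. V x $ i * frechet_derivative (?d i) (at x) e))"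
  proof
    fix e
    show "(\<Sum>i\<in>UNIV. V x $ i * frechet_derivative (?d i) (at x) e + frechet_derivative V (at x) e $ i * ?d i x)
      = frechet_derivative \<phi> (at x) (frechet_derivative V (at x) e) +
      (\<Sum>i\<in>UNIV. V x $ i * frechet_derivative (?d i) (at x) e)"
      using split[OF U(2), of "frechet_derivative V (at x) e"] by (simp add: sum.distrib)
  qed
  ultimately have "((\<lambda>y. \<Sum>i\<in>UNIV. V y $ i * ?d i y) has_derivative
    (\<lambda>e. frechet_derivative \<phi> (at x) (frechet_derivative V (at x) e) +
      (\<Sum>i\<in>UNIV. V x $ i * frechet_derivative (?d i) (at x) e))) (at x)"
    by simp
  then show ?thesis
  proof (rule has_derivative_transform_within_open[OF _ U])
    show "(\<Sum>i\<in>UNIV. V y $ i * ?d i y) = frechet_derivative \<phi> (at y) (V y)" if "y \<in> U" for y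
      using split[OF that, of "V y"] by simp
  qed
qed

text \<open>The sums are the Hessian as a bilinear form in \<open>v\<close> and \<open>w\<close>; in
  the plane, its symmetry is the exchange of the single pair of axes 1 and 2.\<close>

lemma second_derivative_symmetric:
  fixes \<phi> :: "real^2 \<Rightarrow> real"
  assumes U: "open U" "x \<in> U" and \<phi>: "smooth_on U \<phi>"
  shows "(\<Sum>i\<in>UNIV. v $ i * frechet_derivative (\<lambda>y. frechet_derivative \<phi> (at y) (axis i 1)) (at x) w)
       = (\<Sum>i\<in>UNIV. w $ i * frechet_derivative (\<lambda>y. frechet_derivative \<phi> (at y) (axis i 1)) (at x) v)"
proof -
  let ?h = "\<lambda>i. frechet_derivative (\<lambda>y. frechet_derivative \<phi> (at y) (axis i 1)) (at x)"
  have split: "?h i u = (\<Sum>j\<in>UNIV. u $ j * ?h i (axis j 1))" for i u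
  proof -
    have "linear (?h i)"
      using smooth_on_differentiable[OF smooth_on_partial[OF \<phi>] U(2), of "axis i 1"]
      by (intro linear_frechet_derivative) simp
    then interpret linear "?h i" .
    have "u = (\<Sum>i\<in>UNIV. u $ i *\<^sub>R axis i 1)"
      using basis_expansion[of u] by (simp add: scalar_mult_eq_scaleR)
    then have "?h i u = ?h i (\<Sum>j\<in>UNIV. u $ j *\<^sub>R axis j 1)" by (rule arg_cong)
    also have "\<dots> = (\<Sum>j\<in>UNIV. u $ j * ?h i (axis j 1))"
      by (simp only: sum scale real_scaleR_def)
    finally show ?thesis .
  qed
  have "?h 1 (axis 2 1) = ?h 2 (axis 1 1)"
    using U \<phi> by (intro mixed_partials_commute) simp_all
  then show ?thesis
    by (simp add: sum_2 split[of _ v] split[of _ w] algebra_simps)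
qed

section \<open>Calculus in charts\<close>

locale oriented_surface =
  fixes S :: "'a surface"
  assumes surface: "closed_oriented_surface S"
begin

abbreviation dtransition :: "'a chart \<Rightarrow> 'a chart \<Rightarrow> 'a \<Rightarrow> real^2 \<Rightarrow> real^2" where
  "dtransition c d p \<equiv> frechet_derivative (transition c d) (at (snd c p))"

section \<open>Charts, changes of coordinates and tangent vectors\<close>

lemma is_chart: "c \<in> charts S \<Longrightarrow> is_chart (surf_top S) c"
  using surface by (simp add: closed_oriented_surface_def)

lemma chart_subset: "c \<in> charts S \<Longrightarrow> fst c \<subseteq> points S"
  using is_chart[of c] openin_subset[of "surf_top S" "fst c"] by (simp add: is_chart_def)

lemma chart_image_open: "c \<in> charts S \<Longrightarrow> open (snd c ` fst c)"
  using is_chart[of c] by (simp add: is_chart_def)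

lemma chart_inj: "c \<in> charts S \<Longrightarrow> inj_on (snd c) (fst c)"
  using is_chart[of c] chart_subset[of c]
  by (simp add: is_chart_def homeomorphic_map_def Int_absorb1)

lemma chart_inv_of [simp]: "c \<in> charts S \<Longrightarrow> p \<in> fst c \<Longrightarrow> chart_inv c (snd c p) = p"
  by (simp add: chart_inv_def chart_inj)

lemma chart_inv_in: "x \<in> snd c ` fst c \<Longrightarrow> chart_inv c x \<in> fst c"
  by (simp add: chart_inv_def inv_into_into)

lemma chart_of_inv [simp]: "x \<in> snd c ` fst c \<Longrightarrow> snd c (chart_inv c x) = x"
  by (simp add: chart_inv_def f_inv_into_f)

lemma chart_inv_in_points: "c \<in> charts S \<Longrightarrow> x \<in> snd c ` fst c \<Longrightarrow> chart_inv c x \<in> points S"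
  using chart_inv_in[of x c] chart_subset[of c] by auto

lemma chart_image_Int_open:
  assumes "c \<in> charts S" "openin (surf_top S) V"
  shows "open (snd c ` (fst c \<inter> V))"
proof -
  have "open_map (subtopology (surf_top S) (fst c)) (top_of_set (snd c ` fst c)) (snd c)"
    using is_chart[OF assms(1)] by (intro homeomorphic_imp_open_map) (simp add: is_chart_def)
  moreover have "openin (subtopology (surf_top S) (fst c)) (fst c \<inter> V)"
    using assms(2) by (auto simp: openin_subtopology)
  ultimately have "openin (top_of_set (snd c ` fst c)) (snd c ` (fst c \<inter> V))"
    by (auto simp: open_map_def)
  then show ?thesis
    using chart_image_open[OF assms(1)] by (simp add: openin_open_eq)
qed

lemma chart_at: "p \<in> points S \<Longrightarrow> chart_at S p \<in> charts S \<and> p \<in> fst (chart_at S p)"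
proof -
  assume "p \<in> points S"
  then have "\<exists>c. c \<in> charts S \<and> p \<in> fst c"
    using surface unfolding closed_oriented_surface_def by blast
  then show ?thesis unfolding chart_at_def by (rule someI_ex)
qed

lemma openin_chart: "c \<in> charts S \<Longrightarrow> openin (surf_top S) (fst c)"
  using is_chart[of c] by (simp add: is_chart_def)

lemma transition_apply [simp]:
  "c \<in> charts S \<Longrightarrow> p \<in> fst c \<Longrightarrow> transition c d (snd c p) = snd d p"
  by (simp add: transition_def)

lemma transition_differentiable:
  assumes "c \<in> charts S" "d \<in> charts S" "p \<in> fst c" "p \<in> fst d"
  shows "transition c d differentiable (at (snd c p))"
  using surface assms unfolding closed_oriented_surface_def
  by (intro smooth_on_differentiable[of "snd c ` (fst c \<inter> fst d)"]) auto

lemma det_dtransition_pos: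
  assumes "c \<in> charts S" "d \<in> charts S" "p \<in> fst c" "p \<in> fst d"
  shows "det (matrix (dtransition c d p)) > 0"
  using surface assms unfolding closed_oriented_surface_def by blast

lemma linear_dtransition:
  assumes "c \<in> charts S" "d \<in> charts S" "p \<in> fst c" "p \<in> fst d"
  shows "linear (dtransition c d p)"
  using transition_differentiable[OF assms] by (rule linear_frechet_derivative)

text \<open>Chain rule on the overlap of the three charts, an open set where the composed change of
  coordinates agrees with the direct one. This cocycle identity is what makes \<open>tvec_of\<close>
  a tangent vector.\<close>

lemma dtransition_dtransition:
  assumes c: "c \<in> charts S" "p \<in> fst c" and d: "d \<in> charts S" "p \<in> fst d"
    and e: "e \<in> charts S" "p \<in> fst e"
  shows "dtransition d e p (dtransition c d p x) = dtransition c e p x"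
proof -
  let ?U = "snd c ` (fst c \<inter> (fst d \<inter> fst e))"
  have "frechet_derivative (transition d e \<circ> transition c d) (at (snd c p))
      = frechet_derivative (transition c e) (at (snd c p))"
  proof (rule frechet_derivative_transform_within_open[where X = ?U])
    show "transition d e \<circ> transition c d differentiable at (snd c p)"
      using c d e by (intro differentiable_chain_at transition_differentiable) (auto intro!: transition_differentiable)
    show "open ?U"
      using c d e by (intro chart_image_Int_open) (auto intro: openin_chart)
  qed (use c d e in auto)
  moreover have "frechet_derivative (transition d e \<circ> transition c d) (at (snd c p))
      = frechet_derivative (transition d e) (at (transition c d (snd c p))) \<circ> dtransition c d p"
    using c d e by (intro frechet_derivative_compose) (auto intro!: transition_differentiable)
  ultimately show ?thesis using c by (metis comp_apply transition_apply)
qed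

lemma dtransition_same:
  assumes "c \<in> charts S" "p \<in> fst c"
  shows "dtransition c c p x = x"
proof -
  have "frechet_derivative (\<lambda>x. x) (at (snd c p)) = dtransition c c p"
    by (rule frechet_derivative_transform_within_open[where X = "snd c ` fst c"])
      (use assms chart_image_open[of c] in auto)
  from fun_cong[OF this, of x] show ?thesis by (simp only: frechet_derivative_ident)
qed

lemma tangentD:
  assumes "v \<in> tangent_space S p" "c \<in> charts S" "p \<in> fst c" "d \<in> charts S" "p \<in> fst d"
  shows "v d = dtransition c d p (v c)"
  using assms unfolding tangent_space_def by blast

lemma tangent_space_outside: "v \<in> tangent_space S p \<Longrightarrow> \<not> (c \<in> charts S \<and> p \<in> fst c) \<Longrightarrow> v c = 0"
  unfolding tangent_space_def by blast

lemma tangent_spaceI: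
  assumes "\<And>c. \<not> (c \<in> charts S \<and> p \<in> fst c) \<Longrightarrow> v c = 0"
    and "\<And>c d. c \<in> charts S \<Longrightarrow> p \<in> fst c \<Longrightarrow> d \<in> charts S \<Longrightarrow> p \<in> fst d \<Longrightarrow> v d = dtransition c d p (v c)"
  shows "v \<in> tangent_space S p"
  using assms unfolding tangent_space_def by blast

lemma tangent_eqI:
  assumes "u \<in> tangent_space S p" "v \<in> tangent_space S p" "c \<in> charts S" "p \<in> fst c" "u c = v c"
  shows "u = v"
proof
  fix d
  show "u d = v d"
  proof (cases "d \<in> charts S \<and> p \<in> fst d")
    case True
    then show ?thesis using assms tangentD[of u p c d] tangentD[of v p c d] by simp
  next
    case False
    then show ?thesis using assms tangent_space_outside[of u p d] tangent_space_outside[of v p d] by simp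
  qed
qed

lemma tvec_of_apply [simp]: "c \<in> charts S \<Longrightarrow> p \<in> fst c \<Longrightarrow> tvec_of S p c x c = x"
  by (simp add: tvec_of_def dtransition_same)

lemma tvec_of_in [simp]: "c \<in> charts S \<Longrightarrow> p \<in> fst c \<Longrightarrow> tvec_of S p c x \<in> tangent_space S p"
  by (rule tangent_spaceI) (auto simp: tvec_of_def dtransition_dtransition)

lemma tzero_in [simp]: "tzero \<in> tangent_space S p"
  by (rule tangent_spaceI) (simp_all add: tzero_def linear_0[OF linear_dtransition])

lemma lincomb_in [simp]:
  assumes u: "u \<in> tangent_space S p" and v: "v \<in> tangent_space S p"
  shows "lincomb a u b v \<in> tangent_space S p"
proof (rule tangent_spaceI)
  show "lincomb a u b v c = 0" if "\<not> (c \<in> charts S \<and> p \<in> fst c)" for c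
    using tangent_space_outside[OF u that] tangent_space_outside[OF v that] by (simp add: lincomb_def)
  show "lincomb a u b v d = dtransition c d p (lincomb a u b v c)"
    if "c \<in> charts S" "p \<in> fst c" "d \<in> charts S" "p \<in> fst d" for c d
    using tangentD[OF u that] tangentD[OF v that] that
    by (simp add: lincomb_def linear_add[OF linear_dtransition] linear_cmul[OF linear_dtransition])
qed

lemma tangent_space_off: 
  assumes "p \<notin> points S" shows "tangent_space S p = {tzero}"
proof -
  have "v = tzero" if "v \<in> tangent_space S p" for v
    using that assms chart_subset by (force simp: tzero_def intro: tangent_space_outside)
  then show ?thesis by auto
qed

lemma tvec_of_axis:
  assumes "c \<in> charts S" "p \<in> fst c" "v \<in> tangent_space S p"
  shows "lincomb (v c $ 1) (tvec_of S p c (axis 1 1)) (v c $ 2) (tvec_of S p c (axis 2 1)) = v"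
proof (rule tangent_eqI[OF _ assms(3,1,2)])
  show "lincomb (v c $ 1) (tvec_of S p c (axis 1 1)) (v c $ 2) (tvec_of S p c (axis 2 1)) \<in> tangent_space S p"
    using assms by simp
  show "lincomb (v c $ 1) (tvec_of S p c (axis 1 1)) (v c $ 2) (tvec_of S p c (axis 2 1)) c = v c"
    using assms by (simp add: lincomb_def vec_eq_iff forall_2 axis_def)
qed

section \<open>Derivatives of functions along vector fields\<close>

lemma dir_deriv_chart:
  assumes F: "smooth_fun S F" and c: "c \<in> charts S" "p \<in> fst c" and v: "v \<in> tangent_space S p"
  shows "dir_deriv S p v F = frechet_derivative (F \<circ> chart_inv c) (at (snd c p)) (v c)"
proof -
  define d where "d = chart_at S p"
  have d: "d \<in> charts S" "p \<in> fst d"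
    using chart_at[of p] chart_subset[OF c(1)] c(2) unfolding d_def by auto
  let ?U = "snd c ` (fst c \<inter> fst d)"
  have diff: "F \<circ> chart_inv e differentiable at (snd e p)" if "e \<in> charts S" "p \<in> fst e" for e
    using F that by (intro smooth_on_differentiable[of "snd e ` fst e"]) (auto simp: smooth_fun_def)
  have "frechet_derivative ((F \<circ> chart_inv d) \<circ> transition c d) (at (snd c p))
      = frechet_derivative (F \<circ> chart_inv c) (at (snd c p))"
  proof (rule frechet_derivative_transform_within_open[where X = ?U])
    show "(F \<circ> chart_inv d) \<circ> transition c d differentiable at (snd c p)"
      using c d by (intro differentiable_chain_at transition_differentiable) (auto intro: diff)
    show "open ?U"
      using c d by (intro chart_image_Int_open openin_chart)
  qed (use c d in auto)
  moreover have "frechet_derivative ((F \<circ> chart_inv d) \<circ> transition c d) (at (snd c p))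
      = frechet_derivative (F \<circ> chart_inv d) (at (transition c d (snd c p))) \<circ> dtransition c d p"
    using c d by (intro frechet_derivative_compose) (auto intro: diff transition_differentiable)
  ultimately show ?thesis
    using c d tangentD[OF v c d] by (simp add: dir_deriv_def d_def[symmetric] Let_def fun_eq_iff)
qed

lemma dir_deriv_cong:
  assumes "p \<in> points S" "\<And>q. q \<in> points S \<Longrightarrow> F q = G q" "smooth_fun S F"
  shows "dir_deriv S p v F = dir_deriv S p v G"
proof -
  define d where "d = chart_at S p"
  have d: "d \<in> charts S" "p \<in> fst d"
    using chart_at[OF assms(1)] by (auto simp: d_def)
  have "frechet_derivative (F \<circ> chart_inv d) (at (snd d p)) = frechet_derivative (G \<circ> chart_inv d) (at (snd d p))"
  proof (rule frechet_derivative_transform_within_open[where X = "snd d ` fst d"])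
    show "F \<circ> chart_inv d differentiable at (snd d p)"
      using assms(3) d
      by (intro smooth_on_differentiable[of "snd d ` fst d"]) (auto simp: smooth_fun_def)
    show "(F \<circ> chart_inv d) x = (G \<circ> chart_inv d) x" if "x \<in> snd d ` fst d" for x
      using assms(2) chart_inv_in_points[OF d(1) that] by simp
  qed (use d chart_image_open in auto)
  then show ?thesis by (simp add: dir_deriv_def d_def[symmetric] Let_def)
qed

lemma smooth_fun_add: "smooth_fun S F \<Longrightarrow> smooth_fun S G \<Longrightarrow> smooth_fun S (\<lambda>p. F p + G p)"
  by (auto simp: smooth_fun_def o_def intro!: smooth_on_add chart_image_open)

lemma dir_deriv_add:
  assumes "smooth_fun S F" "smooth_fun S G" "p \<in> points S"
  shows "dir_deriv S p v (\<lambda>q. F q + G q) = dir_deriv S p v F + dir_deriv S p v G"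
proof -
  define d where "d = chart_at S p"
  have d: "d \<in> charts S" "p \<in> fst d"
    using chart_at[OF assms(3)] by (auto simp: d_def)
  have hd: "(H \<circ> chart_inv d has_derivative frechet_derivative (H \<circ> chart_inv d) (at (snd d p))) (at (snd d p))"
    if "smooth_fun S H" for H
    using that d unfolding frechet_derivative_works[symmetric]
    by (intro smooth_on_differentiable[of "snd d ` fst d"]) (auto simp: smooth_fun_def)
  show ?thesis
    using frechet_derivative_at[OF has_derivative_add[OF hd[OF assms(1)] hd[OF assms(2)]]]
    by (simp add: dir_deriv_def d_def[symmetric] Let_def o_def fun_eq_iff)
qed

lemma vector_field_in: "vector_field S u \<Longrightarrow> u p \<in> tangent_space S p"
  by (simp add: vector_field_def)

lemma vector_field_off: "vector_field S u \<Longrightarrow> p \<notin> points S \<Longrightarrow> u p = tzero"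
  using vector_field_in[of u p] tangent_space_off by auto

lemma vector_field_smooth:
  "vector_field S u \<Longrightarrow> c \<in> charts S \<Longrightarrow> smooth_on (snd c ` fst c) (\<lambda>x. u (chart_inv c x) c)"
  by (simp add: vector_field_def)

lemma vector_field_lincomb:
  assumes u: "vector_field S u" and v: "vector_field S v"
  shows "vector_field S (\<lambda>p. lincomb a (u p) b (v p))"
  unfolding vector_field_def
proof (intro conjI allI ballI)
  show "lincomb a (u p) b (v p) \<in> tangent_space S p" for p
    by (intro lincomb_in vector_field_in u v)
  show "smooth_on (snd c ` fst c) (\<lambda>x. lincomb a (u (chart_inv c x)) b (v (chart_inv c x)) c)"
    if c: "c \<in> charts S" for c
    unfolding lincomb_def
    by (intro smooth_on_add smooth_on_scaleR smooth_on_const chart_image_open c vector_field_smooth u v)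
qed

text \<open>In coordinates, each iterated derivative is a first-order term containing the derivative
  of a field, plus the Hessian of \<open>F\<close> on the two vectors. The Hessian terms cancel by
  symmetry, and the first-order terms form the bracket.\<close>

lemma dir_deriv_commutator:
  assumes F: "smooth_fun S F" and u: "vector_field S u" and v: "vector_field S v" and p: "p \<in> points S"
  shows "dir_deriv S p (u p) (\<lambda>q. dir_deriv S q (v q) F) - dir_deriv S p (v p) (\<lambda>q. dir_deriv S q (u q) F)
       = dir_deriv S p (lie_bracket S u v p) F"
proof -
  define c where "c = chart_at S p"
  have c: "c \<in> charts S" "p \<in> fst c"
    using chart_at[OF p] by (auto simp: c_def)
  let ?U = "snd c ` fst c"
  let ?\<phi> = "F \<circ> chart_inv c" and ?x = "snd c p"
  let ?c = "\<lambda>w y. w (chart_inv c y) c"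
  have U: "open ?U" "?x \<in> ?U" using c chart_image_open[OF c(1)] by auto
  have \<phi>: "smooth_on ?U ?\<phi>" using F c by (simp add: smooth_fun_def)
  have *: "dir_deriv S p e (\<lambda>q. dir_deriv S q (w q) F) =
     frechet_derivative ?\<phi> (at ?x) (frechet_derivative (?c w) (at ?x) (e c)) +
      (\<Sum>i\<in>UNIV. w p c $ i * frechet_derivative (\<lambda>y. frechet_derivative ?\<phi> (at y) (axis i 1)) (at ?x) (e c))"
    if w: "vector_field S w" for e w
  proof -
    have "((\<lambda>q. dir_deriv S q (w q) F) \<circ> chart_inv c has_derivative
     (\<lambda>e. frechet_derivative ?\<phi> (at ?x) (frechet_derivative (?c w) (at ?x) e) +
      (\<Sum>i\<in>UNIV. ?c w ?x $ i * frechet_derivative (\<lambda>y. frechet_derivative ?\<phi> (at y) (axis i 1)) (at ?x) e))) (at ?x)"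
    proof (rule has_derivative_transform_within_open[OF has_derivative_coordinate_deriv[OF U \<phi>] U])
      show "smooth_on ?U (?c w)" using w c(1) by (rule vector_field_smooth)
      show "frechet_derivative ?\<phi> (at y) (w (chart_inv c y) c) = ((\<lambda>q. dir_deriv S q (w q) F) \<circ> chart_inv c) y"
        if "y \<in> ?U" for y
        using dir_deriv_chart[OF F c(1) chart_inv_in[OF that] vector_field_in[OF w]] that by simp
    qed
    from frechet_derivative_at[OF this, symmetric] show ?thesis
      using c by (simp add: dir_deriv_def c_def[symmetric])
  qed
  interpret linear "frechet_derivative ?\<phi> (at ?x)"
    using smooth_on_differentiable[OF \<phi> U(2)] by (rule linear_frechet_derivative)
  have "dir_deriv S p (lie_bracket S u v p) F = frechet_derivative ?\<phi> (at ?x)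
      (frechet_derivative (?c v) (at ?x) (u p c) - frechet_derivative (?c u) (at ?x) (v p c))"
    using c by (simp add: dir_deriv_def c_def[symmetric] lie_bracket_def)
  then show ?thesis
    using *[OF u, of "v p"] *[OF v, of "u p"]
      second_derivative_symmetric[OF U \<phi>, of "v p c" "u p c"]
    by (simp add: diff)
qed

section \<open>Metrics in coordinates\<close>

lemma metric_component_smooth:
  "riemannian_metric S h \<Longrightarrow> c \<in> charts S \<Longrightarrow> smooth_on (snd c ` fst c)
     (\<lambda>x. h (chart_inv c x) (tvec_of S (chart_inv c x) c (axis i 1)) (tvec_of S (chart_inv c x) c (axis j 1)))"
  by (simp add: riemannian_metric_def)

lemma metric_sym:
  "riemannian_metric S h \<Longrightarrow> p \<in> points S \<Longrightarrow> u \<in> tangent_space S p \<Longrightarrow> v \<in> tangent_space S p \<Longrightarrow>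
    h p u v = h p v u"
  by (simp add: riemannian_metric_def)

lemma metric_pos:
  "riemannian_metric S h \<Longrightarrow> p \<in> points S \<Longrightarrow> u \<in> tangent_space S p \<Longrightarrow> u \<noteq> tzero \<Longrightarrow> h p u u > 0"
  by (simp add: riemannian_metric_def)

lemma metric_lincomb:
  "riemannian_metric S h \<Longrightarrow> p \<in> points S \<Longrightarrow> u \<in> tangent_space S p \<Longrightarrow> v \<in> tangent_space S p \<Longrightarrow>
    w \<in> tangent_space S p \<Longrightarrow> h p (lincomb a u b v) w = a * h p u w + b * h p v w"
  unfolding riemannian_metric_def by blast

lemma metric_lincomb':
  assumes "riemannian_metric S h" "p \<in> points S" "u \<in> tangent_space S p" "v \<in> tangent_space S p"
    "w \<in> tangent_space S p"
  shows "h p w (lincomb a u b v) = a * h p w u + b * h p w v"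
  using metric_sym[OF assms(1,2,5) lincomb_in[OF assms(3,4)], of a b]
  by (simp only: metric_lincomb[OF assms] metric_sym[OF assms(1,2,3,5)] metric_sym[OF assms(1,2,4,5)])

abbreviation metric_comp :: "'a metric_field \<Rightarrow> 'a chart \<Rightarrow> 'a \<Rightarrow> 2 \<Rightarrow> 2 \<Rightarrow> real" where
  "metric_comp h c p i j \<equiv> h p (tvec_of S p c (axis i 1)) (tvec_of S p c (axis j 1))"

lemma metric_coords:
  assumes h: "riemannian_metric S h" and c: "c \<in> charts S" "p \<in> fst c"
    and u: "u \<in> tangent_space S p" and v: "v \<in> tangent_space S p"
  shows "h p u v = metric_comp h c p 1 1 * (u c $ 1 * v c $ 1) +
     metric_comp h c p 1 2 * (u c $ 1 * v c $ 2 + u c $ 2 * v c $ 1) + metric_comp h c p 2 2 * (u c $ 2 * v c $ 2)"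
proof -
  have p: "p \<in> points S" using c chart_subset[OF c(1)] by blast
  have "h p u v = h p (lincomb (u c $ 1) (tvec_of S p c (axis 1 1)) (u c $ 2) (tvec_of S p c (axis 2 1)))
     (lincomb (v c $ 1) (tvec_of S p c (axis 1 1)) (v c $ 2) (tvec_of S p c (axis 2 1)))"
    using tvec_of_axis[OF c u] tvec_of_axis[OF c v] by simp
  then show ?thesis
    using c by (simp add: metric_lincomb[OF h p] metric_lincomb'[OF h p]
        metric_sym[OF h p, of "tvec_of S p c (axis 2 1)" "tvec_of S p c (axis 1 1)"] algebra_simps)
qed

lemma metric_det_pos:
  assumes h: "riemannian_metric S h" and c: "c \<in> charts S" "p \<in> fst c"
  shows "metric_comp h c p 1 1 > 0"
    and "metric_comp h c p 1 1 * metric_comp h c p 2 2 - metric_comp h c p 1 2 * metric_comp h c p 1 2 > 0"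
proof -
  have p: "p \<in> points S" using c chart_subset[OF c(1)] by blast
  have nz: "tvec_of S p c x \<noteq> tzero" if "x \<noteq> 0" for x
    using that tvec_of_apply[OF c, of x] by (metis tzero_def)
  show g: "metric_comp h c p 1 1 > 0"
    using c by (intro metric_pos[OF h p] nz) (auto simp: axis_eq_0_iff)
  \<comment> \<open>\<open>?w\<close> is orthogonal to the first coordinate vector, and its squared
    length is the first metric component times the metric determinant.\<close>
  let ?w = "vector [- metric_comp h c p 1 2, metric_comp h c p 1 1] :: real^2"
  have "?w \<noteq> 0" using g by (auto simp: vec_eq_iff forall_2)
  then have "h p (tvec_of S p c ?w) (tvec_of S p c ?w) > 0"
    using c by (intro metric_pos[OF h p] nz) auto
  then have "metric_comp h c p 1 1 *
     (metric_comp h c p 1 1 * metric_comp h c p 2 2 - metric_comp h c p 1 2 * metric_comp h c p 1 2) > 0"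
    using metric_coords[OF h c tvec_of_in[OF c, of ?w] tvec_of_in[OF c, of ?w]] c
    by (simp add: algebra_simps)
  then show "metric_comp h c p 1 1 * metric_comp h c p 2 2 - metric_comp h c p 1 2 * metric_comp h c p 1 2 > 0"
    using g by (simp add: zero_less_mult_iff)
qed

lemma smooth_on_metric:
  assumes h: "riemannian_metric S h" and c: "c \<in> charts S"
    and X: "\<And>x. x \<in> snd c ` fst c \<Longrightarrow> X x \<in> tangent_space S (chart_inv c x)"
    and Y: "\<And>x. x \<in> snd c ` fst c \<Longrightarrow> Y x \<in> tangent_space S (chart_inv c x)"
    and smooth: "smooth_on (snd c ` fst c) (\<lambda>x. X x c)" "smooth_on (snd c ` fst c) (\<lambda>x. Y x c)"
  shows "smooth_on (snd c ` fst c) (\<lambda>x. h (chart_inv c x) (X x) (Y x))"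
proof -
  have "smooth_on (snd c ` fst c) (\<lambda>x. let q = chart_inv c x in
     metric_comp h c q 1 1 * (X x c $ 1 * Y x c $ 1) +
     metric_comp h c q 1 2 * (X x c $ 1 * Y x c $ 2 + X x c $ 2 * Y x c $ 1) + metric_comp h c q 2 2 * (X x c $ 2 * Y x c $ 2))"
    unfolding Let_def
    by (intro smooth_on_add smooth_on_mult smooth_on_component chart_image_open c metric_component_smooth h smooth)
  then show ?thesis
  proof (rule smooth_on_transform[OF _ chart_image_open[OF c]])
    fix x assume "x \<in> snd c ` fst c"
    from metric_coords[OF h c chart_inv_in[OF this] X[OF this] Y[OF this]]
    show "h (chart_inv c x) (X x) (Y x) = (let q = chart_inv c x in
     metric_comp h c q 1 1 * (X x c $ 1 * Y x c $ 1) +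
     metric_comp h c q 1 2 * (X x c $ 1 * Y x c $ 2 + X x c $ 2 * Y x c $ 1) + metric_comp h c q 2 2 * (X x c $ 2 * Y x c $ 2))"
      by (simp only: Let_def)
  qed
qed

lemma smooth_fun_metric:
  assumes h: "riemannian_metric S h" and u: "vector_field S u" and v: "vector_field S v"
  shows "smooth_fun S (\<lambda>q. h q (u q) (v q))"
  unfolding smooth_fun_def o_def
  by (intro ballI smooth_on_metric h vector_field_in u v vector_field_smooth)

section \<open>Bundle morphisms in coordinates\<close>

lemma morphism_in:
  "bundle_morphism S b \<Longrightarrow> u \<in> tangent_space S p \<Longrightarrow> b p u \<in> tangent_space S p"
  unfolding bundle_morphism_def by blast

lemma morphism_lincomb:
  "bundle_morphism S b \<Longrightarrow> u \<in> tangent_space S p \<Longrightarrow> v \<in> tangent_space S p \<Longrightarrow>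
    b p (lincomb r u s v) = lincomb r (b p u) s (b p v)"
  unfolding bundle_morphism_def by blast

lemma morphism_tzero:
  assumes "bundle_morphism S b"
  shows "b p tzero = tzero"
proof -
  have "(tzero :: 'a tvec) = lincomb 0 tzero 0 tzero" by (simp add: lincomb_def tzero_def)
  then have "b p tzero = b p (lincomb 0 tzero 0 tzero)" by (rule arg_cong)
  also have "\<dots> = tzero"
    unfolding morphism_lincomb[OF assms tzero_in tzero_in] by (simp add: lincomb_def tzero_def)
  finally show ?thesis .
qed

lemma morphism_smooth:
  "bundle_morphism S b \<Longrightarrow> c \<in> charts S \<Longrightarrow>
    smooth_on (snd c ` fst c) (\<lambda>x. b (chart_inv c x) (tvec_of S (chart_inv c x) c (axis i 1)) c)"
  unfolding bundle_morphism_def by blast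

lemma morphism_coords:
  assumes "bundle_morphism S b" "c \<in> charts S" "p \<in> fst c" "u \<in> tangent_space S p"
  shows "b p u c = (u c $ 1) *\<^sub>R b p (tvec_of S p c (axis 1 1)) c + (u c $ 2) *\<^sub>R b p (tvec_of S p c (axis 2 1)) c"
proof -
  have "b p u c = b p (lincomb (u c $ 1) (tvec_of S p c (axis 1 1)) (u c $ 2) (tvec_of S p c (axis 2 1))) c"
    using tvec_of_axis[OF assms(2-)] by simp
  then show ?thesis
    using assms by (simp add: morphism_lincomb) (simp add: lincomb_def)
qed

lemma vector_field_morphism:
  assumes b: "bundle_morphism S b" and u: "vector_field S u"
  shows "vector_field S (\<lambda>p. b p (u p))"
  unfolding vector_field_def
proof (intro conjI allI ballI)
  show "b p (u p) \<in> tangent_space S p" for p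
    using morphism_in[OF b] vector_field_in[OF u] by blast
  fix c assume c: "c \<in> charts S"
  have "smooth_on (snd c ` fst c) (\<lambda>x. let p = chart_inv c x in
      (u p c $ 1) *\<^sub>R b p (tvec_of S p c (axis 1 1)) c + (u p c $ 2) *\<^sub>R b p (tvec_of S p c (axis 2 1)) c)"
    unfolding Let_def
    by (intro smooth_on_add smooth_on_scaleR smooth_on_component chart_image_open c vector_field_smooth u
        morphism_smooth b)
  then show "smooth_on (snd c ` fst c) (\<lambda>x. b (chart_inv c x) (u (chart_inv c x)) c)"
  proof (rule smooth_on_transform[OF _ chart_image_open[OF c]])
    fix x assume "x \<in> snd c ` fst c"
    from morphism_coords[OF b c chart_inv_in[OF this] vector_field_in[OF u]]
    show "b (chart_inv c x) (u (chart_inv c x)) c = (let p = chart_inv c x in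
      (u p c $ 1) *\<^sub>R b p (tvec_of S p c (axis 1 1)) c + (u p c $ 2) *\<^sub>R b p (tvec_of S p c (axis 2 1)) c)"
      by (simp only: Let_def)
  qed
qed

end

section \<open>The complex structure\<close>

text \<open>Orthogonality fixes the direction: \<open>H\<close> times w is the claimed vector
  without its normalisation, multiplied by the coordinate area \<delta> of v and w. The length
  condition then gives H^2 = \<delta>^2 \<Delta>, and the sign of \<delta> selects the root H =
  \<delta> sqrt \<Delta>.\<close>

lemma rotation_coords_unique:
  fixes g11 g12 g22 v1 v2 w1 w2 :: real
  defines "H \<equiv> g11 * (v1 * v1) + g12 * (v1 * v2 + v2 * v1) + g22 * (v2 * v2)"
  assumes det: "g11 * g22 - g12 * g12 > 0" and H: "H > 0"
    and orth: "g11 * (v1 * w1) + g12 * (v1 * w2 + v2 * w1) + g22 * (v2 * w2) = 0"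
    and norm: "g11 * (w1 * w1) + g12 * (w1 * w2 + w2 * w1) + g22 * (w2 * w2) = H"
    and pos: "v1 * w2 - v2 * w1 > 0"
  shows "w1 = - inverse (sqrt (g11 * g22 - g12 * g12)) * (g12 * v1 + g22 * v2)"
    and "w2 = inverse (sqrt (g11 * g22 - g12 * g12)) * (g11 * v1 + g12 * v2)"
proof -
  define \<delta> where "\<delta> = v1 * w2 - v2 * w1"
  define \<Delta> where "\<Delta> = g11 * g22 - g12 * g12"
  have w1: "H * w1 = - \<delta> * (g12 * v1 + g22 * v2)"
  proof -
    have "H * w1 + \<delta> * (g12 * v1 + g22 * v2)
        = v1 * (g11 * (v1 * w1) + g12 * (v1 * w2 + v2 * w1) + g22 * (v2 * w2))"
      unfolding H_def \<delta>_def by (simp add: algebra_simps)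
    then show ?thesis unfolding orth by simp
  qed
  have w2: "H * w2 = \<delta> * (g11 * v1 + g12 * v2)"
  proof -
    have "H * w2 - \<delta> * (g11 * v1 + g12 * v2)
        = v2 * (g11 * (v1 * w1) + g12 * (v1 * w2 + v2 * w1) + g22 * (v2 * w2))"
      unfolding H_def \<delta>_def by (simp add: algebra_simps)
    then show ?thesis unfolding orth by simp
  qed
  have "H\<^sup>2 * (g11 * (w1 * w1) + g12 * (w1 * w2 + w2 * w1) + g22 * (w2 * w2))
     = g11 * ((H * w1) * (H * w1)) + g12 * ((H * w1) * (H * w2) + (H * w2) * (H * w1)) + g22 * ((H * w2) * (H * w2))"
    by (simp add: algebra_simps power2_eq_square)
  also have "\<dots> = \<delta>\<^sup>2 * \<Delta> * H"
    unfolding w1 w2 unfolding H_def \<Delta>_def by (simp add: algebra_simps power2_eq_square)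
  finally have "H\<^sup>2 * H = \<delta>\<^sup>2 * \<Delta> * H" by (simp only: norm)
  then have "H\<^sup>2 = \<delta>\<^sup>2 * \<Delta>" using H by simp
  then have "sqrt (H\<^sup>2) = sqrt (\<delta>\<^sup>2 * \<Delta>)" by simp
  then have "H = \<delta> * sqrt \<Delta>"
    using H pos by (simp add: real_sqrt_mult \<delta>_def)
  moreover have "\<delta> \<noteq> 0" "sqrt \<Delta> \<noteq> 0" using pos det by (auto simp: \<delta>_def \<Delta>_def)
  ultimately have "\<delta> * (sqrt \<Delta> * w1) = \<delta> * (- (g12 * v1 + g22 * v2))"
    "\<delta> * (sqrt \<Delta> * w2) = \<delta> * (g11 * v1 + g12 * v2)"
    using w1 w2 by (simp_all only: mult.assoc mult_minus_left mult_minus_right)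
  then have "sqrt \<Delta> * w1 = - (g12 * v1 + g22 * v2)" "sqrt \<Delta> * w2 = g11 * v1 + g12 * v2"
    using mult_left_cancel[OF \<open>\<delta> \<noteq> 0\<close>] by blast+
  then show "w1 = - inverse (sqrt (g11 * g22 - g12 * g12)) * (g12 * v1 + g22 * v2)"
    and "w2 = inverse (sqrt (g11 * g22 - g12 * g12)) * (g11 * v1 + g12 * v2)"
    using \<open>sqrt \<Delta> \<noteq> 0\<close> unfolding \<Delta>_def by (simp_all add: field_simps)
qed

text \<open>Used to carry positivity of a basis from one chart to the others, since changes of
  coordinates have positive determinant.\<close>

lemma det_linear_image_2:
  fixes f :: "real^2 \<Rightarrow> real^2"
  assumes "linear f"
  shows "f x $ 1 * f y $ 2 - f x $ 2 * f y $ 1 = det (matrix f) * (x $ 1 * y $ 2 - x $ 2 * y $ 1)"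
proof -
  have "f x = matrix f *v x" for x
    using matrix_works[OF assms[folded linear_matrix_vector_mul_eq]] assms by (simp add: matrix_works)
  then have "f x $ i = matrix f $ i $ 1 * x $ 1 + matrix f $ i $ 2 * x $ 2" for x i
    by (simp add: matrix_vector_mult_def sum_2)
  then show ?thesis
    by (simp add: det_2 algebra_simps)
qed

lemma smooth_on_vec2I:
  fixes f :: "'e::euclidean_space \<Rightarrow> real^2"
  assumes "open U" "smooth_on U (\<lambda>x. f x $ 1)" "smooth_on U (\<lambda>x. f x $ 2)"
  shows "smooth_on U f"
proof (rule smooth_on_transform)
  show "smooth_on U (\<lambda>x. f x $ 1 *\<^sub>R axis 1 1 + f x $ 2 *\<^sub>R axis 2 1)"
    by (intro smooth_on_add smooth_on_scaleR smooth_on_const assms)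
qed (simp_all add: assms vec_eq_iff forall_2 axis_def)

lemma lincomb_component: "lincomb a u b v c $ i = a * u c $ i + b * v c $ i"
  by (simp add: lincomb_def)

context oriented_surface
begin

text \<open>Another chart around the same point changes this value by a positive factor, so its
  sign, its vanishing and quotients within one chart are the meaningful data.\<close>

abbreviation area :: "'a chart \<Rightarrow> 'a tvec \<Rightarrow> 'a tvec \<Rightarrow> real" where
  "area c u v \<equiv> u c $ 1 * v c $ 2 - u c $ 2 * v c $ 1"

lemma bundle_morphismI:
  assumes "\<And>p u. u \<in> tangent_space S p \<Longrightarrow> b p u \<in> tangent_space S p"
    and "\<And>p u v r s. u \<in> tangent_space S p \<Longrightarrow> v \<in> tangent_space S p \<Longrightarrow>
           b p (lincomb r u s v) = lincomb r (b p u) s (b p v)"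
    and "\<And>c i. c \<in> charts S \<Longrightarrow>
           smooth_on (snd c ` fst c) (\<lambda>x. b (chart_inv c x) (tvec_of S (chart_inv c x) c (axis i 1)) c)"
  shows "bundle_morphism S b"
  unfolding bundle_morphism_def using assms by blast

lemma bundle_morphism_ident: "bundle_morphism S (\<lambda>p v. v)"
proof (rule bundle_morphismI)
  show "smooth_on (snd c ` fst c) (\<lambda>x. tvec_of S (chart_inv c x) c (axis i 1) c)"
    if c: "c \<in> charts S" for c i
    by (rule smooth_on_transform[OF smooth_on_const[of _ "axis i 1"] chart_image_open[OF c]])
      (rule tvec_of_apply[OF c chart_inv_in])
qed simp_all

lemma bundle_morphism_lincomb:
  assumes A: "bundle_morphism S A" and B: "bundle_morphism S B"
  shows "bundle_morphism S (\<lambda>p v. lincomb a (A p v) b (B p v))"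
proof (rule bundle_morphismI)
  show "lincomb a (A p u) b (B p u) \<in> tangent_space S p" if "u \<in> tangent_space S p" for p u
    using that by (intro lincomb_in morphism_in[OF A] morphism_in[OF B])
  show "lincomb a (A p (lincomb r u s v)) b (B p (lincomb r u s v)) =
      lincomb r (lincomb a (A p u) b (B p u)) s (lincomb a (A p v) b (B p v))"
    if "u \<in> tangent_space S p" "v \<in> tangent_space S p" for p u v r s
    unfolding morphism_lincomb[OF A that] morphism_lincomb[OF B that]
    by (simp add: lincomb_def algebra_simps)
  show "smooth_on (snd c ` fst c)
      (\<lambda>x. lincomb a (A (chart_inv c x) (tvec_of S (chart_inv c x) c (axis i 1))) b
         (B (chart_inv c x) (tvec_of S (chart_inv c x) c (axis i 1))) c)"
    if c: "c \<in> charts S" for c i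
    unfolding lincomb_def
    by (intro smooth_on_add smooth_on_scaleR smooth_on_const chart_image_open c morphism_smooth A B)
qed

lemma bundle_morphism_comp:
  assumes A: "bundle_morphism S A" and B: "bundle_morphism S B"
  shows "bundle_morphism S (\<lambda>p v. A p (B p v))"
proof (rule bundle_morphismI)
  show "A p (B p u) \<in> tangent_space S p" if "u \<in> tangent_space S p" for p u
    using that by (intro morphism_in[OF A] morphism_in[OF B])
  show "A p (B p (lincomb r u s v)) = lincomb r (A p (B p u)) s (A p (B p v))"
    if "u \<in> tangent_space S p" "v \<in> tangent_space S p" for p u v r s
    unfolding morphism_lincomb[OF B that]
    using that by (intro morphism_lincomb[OF A] morphism_in[OF B])
  fix c i assume c: "c \<in> charts S"
  have "smooth_on (snd c ` fst c) (\<lambda>x. let p = chart_inv c x; v = B p (tvec_of S p c (axis i 1)) in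
      (v c $ 1) *\<^sub>R A p (tvec_of S p c (axis 1 1)) c + (v c $ 2) *\<^sub>R A p (tvec_of S p c (axis 2 1)) c)"
    unfolding Let_def
    by (intro smooth_on_add smooth_on_scaleR smooth_on_component chart_image_open c morphism_smooth A B)
  then show "smooth_on (snd c ` fst c)
      (\<lambda>x. A (chart_inv c x) (B (chart_inv c x) (tvec_of S (chart_inv c x) c (axis i 1))) c)"
  proof (rule smooth_on_transform[OF _ chart_image_open[OF c]])
    fix x assume x: "x \<in> snd c ` fst c"
    show "A (chart_inv c x) (B (chart_inv c x) (tvec_of S (chart_inv c x) c (axis i 1))) c
      = (let p = chart_inv c x; v = B p (tvec_of S p c (axis i 1)) in
      (v c $ 1) *\<^sub>R A p (tvec_of S p c (axis 1 1)) c + (v c $ 2) *\<^sub>R A p (tvec_of S p c (axis 2 1)) c)"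
      unfolding Let_def
      by (rule morphism_coords[OF A c chart_inv_in[OF x] morphism_in[OF B tvec_of_in[OF c chart_inv_in[OF x]]]])
  qed
qed

end

section \<open>The quarter turn of a Riemannian metric\<close>

locale riemannian_surface = oriented_surface +
  fixes h :: "'a metric_field"
  assumes riem: "riemannian_metric S h"
begin

lemmas metric_sym = metric_sym[OF riem]
  and metric_pos = metric_pos[OF riem]
  and metric_lincomb = metric_lincomb[OF riem]
  and metric_lincomb' = metric_lincomb'[OF riem]
  and metric_coords = metric_coords[OF riem]
  and metric_det_pos = metric_det_pos[OF riem]
  and smooth_fun_metric = smooth_fun_metric[OF riem]

abbreviation metric_det :: "'a chart \<Rightarrow> 'a \<Rightarrow> real" where
  "metric_det c p \<equiv> metric_comp h c p 1 1 * metric_comp h c p 2 2 - metric_comp h c p 1 2 * metric_comp h c p 1 2"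

lemma metric_tzero [simp]:
  assumes "p \<in> points S" "u \<in> tangent_space S p"
  shows "h p tzero u = 0" "h p u tzero = 0"
proof -
  have "tzero = lincomb 0 tzero 0 tzero" by (simp add: lincomb_def tzero_def)
  then have "h p tzero u = h p (lincomb 0 tzero 0 tzero) u" by (rule arg_cong)
  then show "h p tzero u = 0" using metric_lincomb[OF assms(1) tzero_in tzero_in assms(2)] by simp
  then show "h p u tzero = 0" using metric_sym[OF assms(1) _ assms(2), of tzero] by simp
qed

lemma metric_nondegenerate:
  assumes "p \<in> points S" "u \<in> tangent_space S p" "h p u u = 0"
  shows "u = tzero"
  using metric_pos[OF assms(1,2)] assms(3) by force

text \<open>The matrix of products is X^T G Y, with X and Y the coordinate matrices of the two pairs
  and G that of the metric, so its determinant splits into three. For equal pairs it is a Gram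
  determinant; the mixed case enters the curvature computation.\<close>

lemma metric_cauchy_binet:
  assumes c: "c \<in> charts S" "p \<in> fst c"
    and "x \<in> tangent_space S p" "y \<in> tangent_space S p" "z \<in> tangent_space S p" "w \<in> tangent_space S p"
  shows "h p x z * h p y w - h p x w * h p y z = metric_det c p * area c x y * area c z w"
  unfolding metric_coords[OF c assms(3,5)] metric_coords[OF c assms(4,6)]
    metric_coords[OF c assms(3,6)] metric_coords[OF c assms(4,5)] by (simp add: algebra_simps power2_eq_square)

text \<open>Off \<open>S\<close> nothing is known about \<open>h\<close>, so the description defining \<^const>\<open>complex_structure\<close> may
  be unsatisfiable there and its value junk.\<close>

definition rot :: "'a morphism" where
  "rot p v = (if p \<in> points S then complex_structure S h p v else tzero)"

text \<open>A closed formula from which linearity and smoothness of \<open>J\<close>, hidden behind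
  the \<open>THE\<close>, can be read off. The factor \<open>r\<close> normalises the length, as r^2
  times the metric determinant is 1.\<close>

lemma complex_structure_eq:
  assumes c: "c \<in> charts S" "p \<in> fst c" and v: "v \<in> tangent_space S p"
  defines "r \<equiv> inverse (sqrt (metric_det c p))"
  shows "complex_structure S h p v = tvec_of S p c (vector
     [- r * (metric_comp h c p 1 2 * v c $ 1 + metric_comp h c p 2 2 * v c $ 2),
      r * (metric_comp h c p 1 1 * v c $ 1 + metric_comp h c p 1 2 * v c $ 2)])"
    (is "_ = ?w")
proof -
  have p: "p \<in> points S" using c chart_subset[OF c(1)] by blast
  have det: "metric_det c p > 0" by (rule metric_det_pos(2)[OF c])
  have r: "r * r * metric_det c p = 1" "r > 0"
    using det unfolding r_def by (auto simp: field_simps)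
  have w: "?w \<in> tangent_space S p" using c by simp
  have wc: "?w c $ 1 = - r * (metric_comp h c p 1 2 * v c $ 1 + metric_comp h c p 2 2 * v c $ 2)"
    "?w c $ 2 = r * (metric_comp h c p 1 1 * v c $ 1 + metric_comp h c p 1 2 * v c $ 2)"
    using c by simp_all
  have orth: "h p v ?w = 0"
    unfolding metric_coords[OF c v w] wc by (simp add: algebra_simps power2_eq_square)
  have "h p ?w ?w = r * r * metric_det c p * h p v v"
    unfolding metric_coords[OF c w w] metric_coords[OF c v v] wc by (simp add: algebra_simps power2_eq_square)
  then have norm: "h p ?w ?w = h p v v" using r by simp
  have area: "area c v ?w = r * h p v v"
    unfolding metric_coords[OF c v v] wc by (simp add: algebra_simps power2_eq_square)
  have pos: "positive_basis S p v ?w" if "v \<noteq> tzero"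
    unfolding positive_basis_def
  proof (intro ballI impI)
    fix d assume d: "d \<in> charts S" "p \<in> fst d"
    \<comment> \<open>The pair is positive in \<open>c\<close>; the change of coordinates multiplies
      its area by a positive determinant.\<close>
    have "area d v ?w = det (matrix (dtransition c d p)) * area c v ?w"
      unfolding tangentD[OF v c d] tangentD[OF w c d]
      by (rule det_linear_image_2[OF linear_dtransition[OF c(1) d(1) c(2) d(2)]])
    also have "\<dots> > 0"
      unfolding area using r metric_pos[OF p v that] det_dtransition_pos[OF c(1) d(1) c(2) d(2)] by simp
    finally show "det (vector [v d, ?w d] :: real^2^2) > 0" by (simp add: det_2)
  qed
  show ?thesis
    unfolding complex_structure_def
  proof (rule the_equality)
    show "?w \<in> tangent_space S p \<and> h p v ?w = 0 \<and> h p ?w ?w = h p v v \<and> (v \<noteq> tzero \<longrightarrow> positive_basis S p v ?w)"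
      using w orth norm pos by blast
  next
    fix w' assume w': "w' \<in> tangent_space S p \<and> h p v w' = 0 \<and> h p w' w' = h p v v \<and>
      (v \<noteq> tzero \<longrightarrow> positive_basis S p v w')"
    then have w'T: "w' \<in> tangent_space S p" by simp
    show "w' = ?w"
    \<comment> \<open>For v = 0 the orientation clause is void, and the length condition alone
      forces the rotated vector to be 0.\<close>
    proof (cases "v = tzero")
      case True
      then have "h p w' w' = 0" "h p ?w ?w = 0" using w' norm p by auto
      then show ?thesis using metric_nondegenerate[OF p w'T] metric_nondegenerate[OF p w] by simp
    next
      case False
      have H: "h p v v > 0" by (rule metric_pos[OF p v False])
      have area: "area c v w' > 0"
        using w' False c by (simp add: positive_basis_def det_2)
      have "h p v w' = 0" "h p w' w' = h p v v" using w' by blast+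
      note eqs = this[unfolded metric_coords[OF c v v] metric_coords[OF c v w'T] metric_coords[OF c w'T w'T]]
      note unique = rotation_coords_unique[OF det H[unfolded metric_coords[OF c v v]] eqs area]
      have "w' c $ 1 = ?w c $ 1"
        unfolding wc unfolding r_def by (rule unique(1))
      moreover have "w' c $ 2 = ?w c $ 2"
        unfolding wc unfolding r_def by (rule unique(2))
      ultimately have "w' c = ?w c" by (simp add: vec_eq_iff forall_2)
      then show ?thesis by (rule tangent_eqI[OF w'T w c])
    qed
  qed
qed

lemma rot_coords:
  assumes c: "c \<in> charts S" "p \<in> fst c" and v: "v \<in> tangent_space S p"
  shows "rot p v c $ 1 = - inverse (sqrt (metric_det c p)) *
      (metric_comp h c p 1 2 * v c $ 1 + metric_comp h c p 2 2 * v c $ 2)"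
    and "rot p v c $ 2 = inverse (sqrt (metric_det c p)) *
      (metric_comp h c p 1 1 * v c $ 1 + metric_comp h c p 1 2 * v c $ 2)"
proof -
  have "p \<in> points S" using c chart_subset[OF c(1)] by blast
  then show "rot p v c $ 1 = - inverse (sqrt (metric_det c p)) *
      (metric_comp h c p 1 2 * v c $ 1 + metric_comp h c p 2 2 * v c $ 2)"
    "rot p v c $ 2 = inverse (sqrt (metric_det c p)) *
      (metric_comp h c p 1 1 * v c $ 1 + metric_comp h c p 1 2 * v c $ 2)"
    using c by (simp_all add: rot_def complex_structure_eq[OF c v])
qed

lemma rot_in:
  assumes "v \<in> tangent_space S p"
  shows "rot p v \<in> tangent_space S p"
proof (cases "p \<in> points S")
  case True
  note c = conjunct1[OF chart_at[OF True]] conjunct2[OF chart_at[OF True]]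
  show ?thesis using True tvec_of_in[OF c] by (simp add: rot_def complex_structure_eq[OF c assms])
qed (simp add: rot_def)

text \<open>Smoothness rests on the positivity of the metric determinant, which keeps the inverse
  square root in the coordinate formula smooth.\<close>

lemma bundle_morphism_rot: "bundle_morphism S rot"
proof (rule bundle_morphismI[OF rot_in])
  show "rot p (lincomb r u s v) = lincomb r (rot p u) s (rot p v)"
    if u: "u \<in> tangent_space S p" and v: "v \<in> tangent_space S p" for p u v r s
  proof (cases "p \<in> points S")
    case True
    note c = conjunct1[OF chart_at[OF True]] conjunct2[OF chart_at[OF True]]
    have "rot p (lincomb r u s v) (chart_at S p) $ 1 = lincomb r (rot p u) s (rot p v) (chart_at S p) $ 1"
      "rot p (lincomb r u s v) (chart_at S p) $ 2 = lincomb r (rot p u) s (rot p v) (chart_at S p) $ 2"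
      unfolding lincomb_component rot_coords[OF c lincomb_in[OF u v]] rot_coords[OF c u] rot_coords[OF c v]
      by (simp_all add: algebra_simps)
    then show ?thesis
      by (intro tangent_eqI[OF rot_in[OF lincomb_in[OF u v]] lincomb_in[OF rot_in[OF u] rot_in[OF v]] c])
        (simp add: vec_eq_iff forall_2)
  qed (simp add: rot_def lincomb_def tzero_def)
  fix c i assume c: "c \<in> charts S"
  let ?U = "snd c ` fst c"
  let ?e = "axis i 1 :: real^2"
  let ?r = "\<lambda>x. inverse (sqrt (metric_det c (chart_inv c x)))"
  note U = chart_image_open[OF c]
  note intros = smooth_on_add smooth_on_mult smooth_on_diff smooth_on_const U metric_component_smooth[OF riem c]
  have r: "smooth_on ?U ?r"
    by (intro smooth_on_inverse_sqrt intros metric_det_pos(2)[OF c chart_inv_in])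
  show "smooth_on ?U (\<lambda>x. rot (chart_inv c x) (tvec_of S (chart_inv c x) c ?e) c)"
  proof (rule smooth_on_vec2I[OF U])
    have "smooth_on ?U (\<lambda>x. (- 1 * ?r x) *
      (metric_comp h c (chart_inv c x) 1 2 * ?e $ 1 + metric_comp h c (chart_inv c x) 2 2 * ?e $ 2))"
      by (intro intros r)
    then show "smooth_on ?U (\<lambda>x. rot (chart_inv c x) (tvec_of S (chart_inv c x) c ?e) c $ 1)"
    proof (rule smooth_on_transform[OF _ U])
      fix x assume x: "x \<in> ?U"
      show "rot (chart_inv c x) (tvec_of S (chart_inv c x) c ?e) c $ 1 = (- 1 * ?r x) *
      (metric_comp h c (chart_inv c x) 1 2 * ?e $ 1 + metric_comp h c (chart_inv c x) 2 2 * ?e $ 2)"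
        using rot_coords(1)[OF c chart_inv_in[OF x] tvec_of_in[OF c chart_inv_in[OF x]], of ?e]
        unfolding tvec_of_apply[OF c chart_inv_in[OF x]] by simp
    qed
    have "smooth_on ?U (\<lambda>x. ?r x *
      (metric_comp h c (chart_inv c x) 1 1 * ?e $ 1 + metric_comp h c (chart_inv c x) 1 2 * ?e $ 2))"
      by (intro intros r)
    then show "smooth_on ?U (\<lambda>x. rot (chart_inv c x) (tvec_of S (chart_inv c x) c ?e) c $ 2)"
    proof (rule smooth_on_transform[OF _ U])
      fix x assume x: "x \<in> ?U"
      show "rot (chart_inv c x) (tvec_of S (chart_inv c x) c ?e) c $ 2 = ?r x *
      (metric_comp h c (chart_inv c x) 1 1 * ?e $ 1 + metric_comp h c (chart_inv c x) 1 2 * ?e $ 2)"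
        using rot_coords(2)[OF c chart_inv_in[OF x] tvec_of_in[OF c chart_inv_in[OF x]], of ?e]
        unfolding tvec_of_apply[OF c chart_inv_in[OF x]] by simp
    qed
  qed
qed

lemma metric_rot:
  assumes p: "p \<in> points S" and u: "u \<in> tangent_space S p" and v: "v \<in> tangent_space S p"
  shows "h p (rot p u) (rot p v) = h p u v" and "h p u (rot p v) = - h p (rot p u) v"
proof -
  note c = conjunct1[OF chart_at[OF p]] conjunct2[OF chart_at[OF p]]
  let ?c = "chart_at S p"
  define r where "r = inverse (sqrt (metric_det ?c p))"
  have r: "r * r * metric_det ?c p = 1"
    using metric_det_pos(2)[OF c] unfolding r_def by (auto simp: field_simps)
  have "h p (rot p u) (rot p v) = r * r * metric_det ?c p * h p u v"
    unfolding metric_coords[OF c u v] metric_coords[OF c rot_in[OF u] rot_in[OF v]]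
      rot_coords[OF c u] rot_coords[OF c v] r_def[symmetric] by (simp add: algebra_simps power2_eq_square)
  then show "h p (rot p u) (rot p v) = h p u v" using r by simp
  show "h p u (rot p v) = - h p (rot p u) v"
    unfolding metric_coords[OF c u rot_in[OF v]] metric_coords[OF c rot_in[OF u] v]
      rot_coords[OF c u] rot_coords[OF c v] r_def[symmetric] by (simp add: algebra_simps power2_eq_square)
qed

lemma metric_rot_self:
  assumes "p \<in> points S" "u \<in> tangent_space S p"
  shows "h p u (rot p u) = 0"
  using metric_rot(2)[OF assms assms(2)] metric_sym[OF assms rot_in[OF assms(2)]] by simp

text \<open>In the chart, \<open>J\<close> is r Q G with G the metric matrix and Q the standard
  quarter turn. Self-adjointness makes G b symmetric, so the diagonal entries of Q G b are opposite,
  and the determinant of \<open>J b\<close> is r^2 det G det b = 1.\<close>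

lemma rot_coords_self_adjoint:
  assumes b: "bundle_morphism S b" and p: "p \<in> points S"
    and sa: "\<And>u v. u \<in> tangent_space S p \<Longrightarrow> v \<in> tangent_space S p \<Longrightarrow> h p (b p u) v = h p u (b p v)"
    and det: "morphism_det S b p = 1"
  obtains \<alpha> \<beta> \<gamma> where "\<alpha> * \<alpha> + \<beta> * \<gamma> = -1"
    "\<And>u. u \<in> tangent_space S p \<Longrightarrow> rot p (b p u) (chart_at S p) $ 1 = \<alpha> * u (chart_at S p) $ 1 + \<beta> * u (chart_at S p) $ 2"
    "\<And>u. u \<in> tangent_space S p \<Longrightarrow> rot p (b p u) (chart_at S p) $ 2 = \<gamma> * u (chart_at S p) $ 1 - \<alpha> * u (chart_at S p) $ 2"
proof -
  note c = conjunct1[OF chart_at[OF p]] conjunct2[OF chart_at[OF p]]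
  let ?c = "chart_at S p"
  define r where "r = inverse (sqrt (metric_det ?c p))"
  have r: "r * r * metric_det ?c p = 1"
    using metric_det_pos(2)[OF c] unfolding r_def by (auto simp: field_simps)
  define e where "e i = tvec_of S p ?c (axis i 1)" for i
  have e: "e i \<in> tangent_space S p" for i using c by (simp add: e_def)
  have ec: "e 1 ?c $ 1 = 1" "e 1 ?c $ 2 = 0" "e 2 ?c $ 1 = 0" "e 2 ?c $ 2 = 1"
    using c by (simp_all add: e_def axis_def)
  define m where "m i j = b p (e j) ?c $ i" for i j
  have m: "m 1 1 * m 2 2 - m 1 2 * m 2 1 = 1"
    using det by (simp add: morphism_det_def Let_def det_2 matrix_def m_def e_def)
  have sym: "metric_comp h ?c p 1 2 * m 1 1 + metric_comp h ?c p 2 2 * m 2 1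
     = metric_comp h ?c p 1 1 * m 1 2 + metric_comp h ?c p 1 2 * m 2 2"
    using sa[OF e e, of 1 2]
    unfolding metric_coords[OF c e morphism_in[OF b e]] metric_coords[OF c morphism_in[OF b e] e] ec m_def
    by simp
  have bc: "b p u ?c $ i = u ?c $ 1 * m i 1 + u ?c $ 2 * m i 2" if "u \<in> tangent_space S p" for u i
    using morphism_coords[OF b c that] by (simp add: m_def e_def)
  show ?thesis
  proof
    let ?\<alpha> = "- r * (metric_comp h ?c p 1 2 * m 1 1 + metric_comp h ?c p 2 2 * m 2 1)"
    let ?\<beta> = "- r * (metric_comp h ?c p 1 2 * m 1 2 + metric_comp h ?c p 2 2 * m 2 2)"
    let ?\<gamma> = "r * (metric_comp h ?c p 1 1 * m 1 1 + metric_comp h ?c p 1 2 * m 2 1)"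
    \<comment> \<open>One of the two equal factors is rewritten by the symmetry of G b, so that
      adding \<open>?\<beta> * ?\<gamma>\<close> produces the product of the determinants of G and
      b.\<close>
    have "?\<alpha> * ?\<alpha> = r * r * (metric_comp h ?c p 1 2 * m 1 1 + metric_comp h ?c p 2 2 * m 2 1)
        * (metric_comp h ?c p 1 1 * m 1 2 + metric_comp h ?c p 1 2 * m 2 2)"
      unfolding sym[symmetric] by simp
    then have "?\<alpha> * ?\<alpha> + ?\<beta> * ?\<gamma> = - (r * r * metric_det ?c p) * (m 1 1 * m 2 2 - m 1 2 * m 2 1)"
      by (simp add: algebra_simps power2_eq_square)
    then show "?\<alpha> * ?\<alpha> + ?\<beta> * ?\<gamma> = - 1" unfolding r m by simp
    fix u assume u: "u \<in> tangent_space S p"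
    show "rot p (b p u) ?c $ 1 = ?\<alpha> * u ?c $ 1 + ?\<beta> * u ?c $ 2"
      unfolding rot_coords[OF c morphism_in[OF b u]] bc[OF u] r_def by (simp add: algebra_simps power2_eq_square)
    have "rot p (b p u) ?c $ 2 = ?\<gamma> * u ?c $ 1 + r * (metric_comp h ?c p 1 1 * m 1 2 + metric_comp h ?c p 1 2 * m 2 2) * u ?c $ 2"
      unfolding rot_coords[OF c morphism_in[OF b u]] bc[OF u] r_def by (simp add: algebra_simps power2_eq_square)
    then show "rot p (b p u) ?c $ 2 = ?\<gamma> * u ?c $ 1 - ?\<alpha> * u ?c $ 2"
      unfolding sym[symmetric] by simp
  qed
qed

text \<open>\<open>lincomb (-1) v 0 v\<close> is -v, kept in the form to which the linearity lemmas
  apply.\<close>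

lemma rot_rot:
  assumes v: "v \<in> tangent_space S p"
  shows "rot p (rot p v) = lincomb (-1) v 0 v"
proof (cases "p \<in> points S")
  case True
  note c = conjunct1[OF chart_at[OF True]] conjunct2[OF chart_at[OF True]]
  let ?c = "chart_at S p"
  define r where "r = inverse (sqrt (metric_det ?c p))"
  have r: "r * r * metric_det ?c p = 1"
    using metric_det_pos(2)[OF c] unfolding r_def by (auto simp: field_simps)
  have "rot p (rot p v) ?c $ 1 = - (r * r * metric_det ?c p) * v ?c $ 1"
    "rot p (rot p v) ?c $ 2 = - (r * r * metric_det ?c p) * v ?c $ 2"
    unfolding rot_coords[OF c rot_in[OF v]] rot_coords[OF c v] r_def[symmetric] by (simp_all add: algebra_simps power2_eq_square)
  then have "rot p (rot p v) ?c = lincomb (-1) v 0 v ?c"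
    unfolding r by (simp add: vec_eq_iff forall_2 lincomb_def)
  then show ?thesis by (rule tangent_eqI[OF rot_in[OF rot_in[OF v]] lincomb_in[OF v v] c])
next
  case False
  then have "v = tzero" using v tangent_space_off by blast
  then show ?thesis using False by (simp add: rot_def lincomb_def tzero_def)
qed

end

section \<open>Levi-Civita connections\<close>

context riemannian_surface
begin

text \<open>The Gram determinant of v and J v is h(v,v)^2, and Cauchy-Binet factors it through the
  area.\<close>

lemma area_rot_nonzero:
  assumes "p \<in> points S" "v \<in> tangent_space S p" "v \<noteq> tzero"
  shows "area (chart_at S p) v (rot p v) \<noteq> 0"
proof
  note c = conjunct1[OF chart_at[OF assms(1)]] conjunct2[OF chart_at[OF assms(1)]]
  assume "area (chart_at S p) v (rot p v) = 0"
  with metric_cauchy_binet[OF c assms(2) rot_in[OF assms(2)] assms(2) rot_in[OF assms(2)]]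
  have "h p v v * h p (rot p v) (rot p v) - h p v (rot p v) * h p (rot p v) v = 0" by simp
  then have "h p v v * h p v v = 0"
    using metric_rot(1)[OF assms(1,2,2)] metric_rot_self[OF assms(1,2)] by simp
  then show False using metric_pos[OF assms] by simp
qed

text \<open>Cramer's rule in the chart: the coefficients are quotients of areas.\<close>

lemma area_spans:
  assumes p: "p \<in> points S" and u: "u \<in> tangent_space S p" and v: "v \<in> tangent_space S p"
    and w: "w \<in> tangent_space S p" and nz: "area (chart_at S p) u v \<noteq> 0"
  obtains a b where "w = lincomb a u b v"
proof
  note c = conjunct1[OF chart_at[OF p]] conjunct2[OF chart_at[OF p]]
  let ?c = "chart_at S p"
  have solve: "y = a / d * x + b / d * x'" if "d * y = a * x + b * x'" "d \<noteq> 0" for a b d x x' y :: real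
    using that by (simp add: field_simps)
  have "area ?c u v * w ?c $ i = area ?c w v * u ?c $ i + area ?c u w * v ?c $ i" for i
    using exhaust_2[of i] by (auto simp: algebra_simps)
  then have "w ?c $ i = lincomb (area ?c w v / area ?c u v) u (area ?c u w / area ?c u v) v ?c $ i" for i
    unfolding lincomb_component by (rule solve[OF _ nz])
  then have "w ?c = lincomb (area ?c w v / area ?c u v) u (area ?c u w / area ?c u v) v ?c"
    unfolding vec_eq_iff by blast
  then show "w = lincomb (area ?c w v / area ?c u v) u (area ?c u w / area ?c u v) v"
    by (rule tangent_eqI[OF w lincomb_in[OF u v] c])
qed

end

section \<open>Calculus of the Levi-Civita connection\<close>

locale levi_civita_surface = riemannian_surface +
  fixes D :: "'a connection"
  assumes lc: "levi_civita S h D"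
begin

lemma smooth_fun_const: "smooth_fun S (\<lambda>p. a)"
  by (auto simp: smooth_fun_def o_def smooth_on_const)

lemma affine: "affine_connection S D"
  using lc by (simp add: levi_civita_def)

lemma conn_field: 
  assumes "vector_field S u" "vector_field S v"
  shows "vector_field S (D u v)"
  using affine assms smooth_fun_const unfolding affine_connection_def by blast

lemma conn_lincomb_left_fun:
  assumes "vector_field S u" "vector_field S v" "vector_field S w" "smooth_fun S f" "smooth_fun S g"
  shows "D (\<lambda>p. lincomb (f p) (u p) (g p) (v p)) w = (\<lambda>p. lincomb (f p) (D u w p) (g p) (D v w p))"
  using affine assms unfolding affine_connection_def by blast

lemma conn_lincomb_left:
  assumes "vector_field S u" "vector_field S v" "vector_field S w"
  shows "D (\<lambda>p. lincomb a (u p) b (v p)) w = (\<lambda>p. lincomb a (D u w p) b (D v w p))"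
  by (rule conn_lincomb_left_fun[OF assms smooth_fun_const smooth_fun_const])

lemma conn_add_right:
  assumes "vector_field S u" "vector_field S v" "vector_field S w"
  shows "D u (\<lambda>p. lincomb 1 (v p) 1 (w p)) = (\<lambda>p. lincomb 1 (D u v p) 1 (D u w p))"
  using affine assms smooth_fun_const unfolding affine_connection_def by blast

lemma conn_scale_right:
  assumes "vector_field S u" "vector_field S v" "smooth_fun S f"
  shows "D u (\<lambda>p c. f p *\<^sub>R v p c) = (\<lambda>p. lincomb (dir_deriv S p (u p) f) (v p) (f p) (D u v p))"
  using affine assms unfolding affine_connection_def by blast

text \<open>The axioms give additivity and the Leibniz rule; a constant coefficient has vanishing
  derivative, so the extra Leibniz term disappears.\<close>

lemma conn_lincomb_right:
  assumes u: "vector_field S u" and v: "vector_field S v" and w: "vector_field S w"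
  shows "D u (\<lambda>p. lincomb a (v p) b (w p)) = (\<lambda>p. lincomb a (D u v p) b (D u w p))"
proof -
  have scale: "(\<lambda>p c. r *\<^sub>R x p c) = (\<lambda>p. lincomb r (x p) 0 (x p))" for r and x :: "'a vfield"
    by (simp add: lincomb_def)
  have field: "vector_field S (\<lambda>p c. r *\<^sub>R x p c)" if "vector_field S x" for r x
    unfolding scale using that that by (rule vector_field_lincomb)
  have D_scale: "D u (\<lambda>p c. r *\<^sub>R x p c) = (\<lambda>p c. r *\<^sub>R D u x p c)" if "vector_field S x" for r x
    unfolding conn_scale_right[OF u that smooth_fun_const]
    by (simp add: dir_deriv_def o_def lincomb_def)
  have "(\<lambda>p. lincomb a (v p) b (w p)) = (\<lambda>p. lincomb 1 (\<lambda>c. a *\<^sub>R v p c) 1 (\<lambda>c. b *\<^sub>R w p c))"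
    by (simp add: lincomb_def)
  then have "D u (\<lambda>p. lincomb a (v p) b (w p)) = D u (\<lambda>p. lincomb 1 (\<lambda>c. a *\<^sub>R v p c) 1 (\<lambda>c. b *\<^sub>R w p c))"
    by (rule arg_cong)
  also have "\<dots> = (\<lambda>p. lincomb 1 (\<lambda>c. a *\<^sub>R D u v p c) 1 (\<lambda>c. b *\<^sub>R D u w p c))"
    unfolding conn_add_right[OF u field[OF v] field[OF w]] D_scale[OF v] D_scale[OF w] ..
  finally show ?thesis by (simp add: lincomb_def)
qed

lemma torsion_free:
  assumes "vector_field S u" "vector_field S v"
  shows "lie_bracket S u v = (\<lambda>p. lincomb 1 (D u v p) (-1) (D v u p))"
proof -
  have "(\<lambda>p. lincomb 1 (D u v p) (-1) (D v u p)) = lie_bracket S u v"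
    using lc assms unfolding levi_civita_def by blast
  then show ?thesis by (rule sym)
qed

text \<open>Torsion-freeness exhibits the bracket as a difference of covariant derivatives, which
  bypasses its transformation law under changes of coordinates.\<close>

lemma lie_bracket_field: "vector_field S u \<Longrightarrow> vector_field S v \<Longrightarrow> vector_field S (lie_bracket S u v)"
  by (simp add: torsion_free vector_field_lincomb conn_field)

lemma metric_compatible:
  assumes "vector_field S u" "vector_field S v" "vector_field S w" "p \<in> points S"
  shows "dir_deriv S p (u p) (\<lambda>q. h q (v q) (w q)) = h p (D u v p) (w p) + h p (v p) (D u w p)"
  using lc assms unfolding levi_civita_def by blast

section \<open>The curvature tensor and its symmetries\<close>

abbreviation R :: "'a vfield \<Rightarrow> 'a vfield \<Rightarrow> 'a vfield \<Rightarrow> 'a vfield" where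
  "R \<equiv> curvature_tensor S D"

lemma curvature_eq: "R u v w = (\<lambda>p. lincomb 1 (lincomb 1 (D u (D v w) p) (-1) (D v (D u w) p)) (-1)
    (D (lie_bracket S u v) w p))"
  by (simp add: curvature_tensor_def lincomb_def fun_eq_iff)

lemma curvature_field:
  "vector_field S u \<Longrightarrow> vector_field S v \<Longrightarrow> vector_field S w \<Longrightarrow> vector_field S (R u v w)"
  unfolding curvature_eq by (intro vector_field_lincomb conn_field lie_bracket_field)

text \<open>Apply the commutator formula to the function h(w, z) and expand by metric compatibility.
  The terms with one derivative on each factor are symmetric in \<open>u\<close> and
  \<open>v\<close> and cancel.\<close>

lemma curvature_skew:
  assumes u: "vector_field S u" and v: "vector_field S v" and w: "vector_field S w" and z: "vector_field S z"
    and p: "p \<in> points S"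
  shows "h p (R u v w p) (z p) = - h p (w p) (R u v z p)"
proof -
  let ?F = "\<lambda>q. h q (w q) (z q)"
  have second: "dir_deriv S p (x p) (\<lambda>q. dir_deriv S q (y q) ?F) =
      h p (D x (D y w) p) (z p) + h p (D y w p) (D x z p) + (h p (D x w p) (D y z p) + h p (w p) (D x (D y z) p))"
    if x: "vector_field S x" and y: "vector_field S y" for x y
  proof -
    have F: "smooth_fun S (\<lambda>q. h q (D y w q) (z q))" "smooth_fun S (\<lambda>q. h q (w q) (D y z q))"
      by (intro smooth_fun_metric conn_field w y z)+
    have "dir_deriv S p (x p) (\<lambda>q. h q (D y w q) (z q) + h q (w q) (D y z q))
        = dir_deriv S p (x p) (\<lambda>q. dir_deriv S q (y q) ?F)"
      by (rule dir_deriv_cong[OF p _ smooth_fun_add[OF F]]) (simp add: metric_compatible[OF y w z])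
    then show ?thesis
      unfolding dir_deriv_add[OF F p] metric_compatible[OF x conn_field[OF y w] z p]
        metric_compatible[OF x w conn_field[OF y z] p] by simp
  qed
  have F: "smooth_fun S ?F" by (intro smooth_fun_metric w z)
  note field_in = vector_field_in[OF conn_field] lincomb_in vector_field_in[OF w] vector_field_in[OF z]
    conn_field u v w z lie_bracket_field
  have "h p (R u v w p) (z p) = h p (D u (D v w) p) (z p) - h p (D v (D u w) p) (z p)
      - h p (D (lie_bracket S u v) w p) (z p)"
    unfolding curvature_eq by (simp add: metric_lincomb[OF p] field_in)
  moreover have "h p (w p) (R u v z p) = h p (w p) (D u (D v z) p) - h p (w p) (D v (D u z) p)
      - h p (w p) (D (lie_bracket S u v) z p)"
    unfolding curvature_eq by (simp add: metric_lincomb'[OF p] field_in)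
  moreover note dir_deriv_commutator[OF F u v p] second[OF u v] second[OF v u]
    metric_compatible[OF lie_bracket_field[OF u v] w z p]
  ultimately show ?thesis by linarith
qed

lemma curvature_lincomb_right:
  assumes u: "vector_field S u" and v: "vector_field S v" and w: "vector_field S w" and z: "vector_field S z"
  shows "R u v (\<lambda>p. lincomb a (w p) b (z p)) = (\<lambda>p. lincomb a (R u v w p) b (R u v z p))"
  unfolding curvature_eq
  by (simp add: conn_lincomb_right conn_field u v w z lie_bracket_field)
    (simp add: lincomb_def algebra_simps)

lemma curvature_swap:
  assumes u: "vector_field S u" and v: "vector_field S v" and w: "vector_field S w"
  shows "R v u w = (\<lambda>p. lincomb (-1) (R u v w p) 0 (R u v w p))"
proof -
  have "lie_bracket S v u = (\<lambda>p. lincomb (-1) (lie_bracket S u v p) 0 (lie_bracket S u v p))"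
    by (simp add: lie_bracket_def lincomb_def fun_eq_iff)
  then show ?thesis
    unfolding curvature_eq
    by (simp add: conn_lincomb_left conn_field u v w lie_bracket_field)
      (simp add: lincomb_def algebra_simps)
qed

lemma curvature_lincomb_mid:
  assumes u: "vector_field S u" and v: "vector_field S v" and x: "vector_field S x" and w: "vector_field S w"
  shows "R u (\<lambda>p. lincomb a (v p) b (x p)) w = (\<lambda>p. lincomb a (R u v w p) b (R u x w p))"
proof -
  have "lie_bracket S u (\<lambda>p. lincomb a (v p) b (x p))
      = (\<lambda>p. lincomb a (lie_bracket S u v p) b (lie_bracket S u x p))"
    by (simp add: torsion_free u v x vector_field_lincomb conn_lincomb_left conn_lincomb_right)
      (simp add: lincomb_def algebra_simps)
  then show ?thesis
    unfolding curvature_eq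
    by (simp add: conn_lincomb_left conn_lincomb_right conn_field u v x w lie_bracket_field)
      (simp add: lincomb_def algebra_simps)
qed

section \<open>The complex structure is parallel\<close>

lemma rot_parallel:
  assumes u: "vector_field S u" and v: "vector_field S v"
  shows "D u (\<lambda>q. rot q (v q)) = (\<lambda>p. rot p (D u v p))"
proof -
  \<comment> \<open>\<open>A = (\<nabla>\<^sub>u J)\<close> is skew and anticommutes with \<open>J\<close>; in dimension 2 this forces \<open>A = 0\<close>.\<close>
  note rot_field = vector_field_morphism[OF bundle_morphism_rot]
  define A where "A w p = lincomb 1 (D u (\<lambda>q. rot q (w q)) p) (-1) (rot p (D u w p))" for w p
  have A_field: "vector_field S (A w)" if "vector_field S w" for w
    using that unfolding A_def by (intro vector_field_lincomb conn_field rot_field u)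
  \<comment> \<open>The derivative along \<open>u\<close> of the identity h(J x, J y) = h(x,
    y).\<close>
  have i: "h p (A x p) (rot p (y p)) = - h p (rot p (x p)) (A y p)"
    if x: "vector_field S x" and y: "vector_field S y" and p: "p \<in> points S" for x y p
  proof -
    have "dir_deriv S p (u p) (\<lambda>q. h q (x q) (y q)) = dir_deriv S p (u p) (\<lambda>q. h q (rot q (x q)) (rot q (y q)))"
      by (rule dir_deriv_cong[OF p _ smooth_fun_metric[OF x y]])
        (simp add: metric_rot(1) vector_field_in x y)
    then have "h p (D u (\<lambda>q. rot q (x q)) p) (rot p (y p)) + h p (rot p (x p)) (D u (\<lambda>q. rot q (y q)) p)
       = h p (D u x p) (y p) + h p (x p) (D u y p)"
      unfolding metric_compatible[OF u x y p] metric_compatible[OF u rot_field[OF x] rot_field[OF y] p] by simp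
    moreover have "h p (rot p (D u x p)) (rot p (y p)) = h p (D u x p) (y p)"
      "h p (rot p (x p)) (rot p (D u y p)) = h p (x p) (D u y p)"
      by (intro metric_rot(1) p vector_field_in conn_field u x y)+
    moreover have "h p (A x p) (rot p (y p)) = h p (D u (\<lambda>q. rot q (x q)) p) (rot p (y p)) - h p (rot p (D u x p)) (rot p (y p))"
      unfolding A_def
      by (subst metric_lincomb[OF p]) (auto intro!: vector_field_in conn_field rot_in rot_field u x y)
    moreover have "h p (rot p (x p)) (A y p) = h p (rot p (x p)) (D u (\<lambda>q. rot q (y q)) p) - h p (rot p (x p)) (rot p (D u y p))"
      unfolding A_def
      by (subst metric_lincomb'[OF p]) (auto intro!: vector_field_in conn_field rot_in rot_field u x y)
    ultimately show ?thesis by linarith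
  qed
  \<comment> \<open>The derivative along \<open>u\<close> of the identity J^2 = -E.\<close>
  have ii: "A (\<lambda>q. rot q (w q)) p = lincomb (-1) (rot p (A w p)) 0 (rot p (A w p))"
    if w: "vector_field S w" for w p
  proof -
    have "(\<lambda>q. rot q (rot q (w q))) = (\<lambda>q. lincomb (-1) (w q) 0 (w q))"
      by (simp add: rot_rot vector_field_in w)
    then have "D u (\<lambda>q. rot q (rot q (w q))) = (\<lambda>p. lincomb (-1) (D u w p) 0 (D u w p))"
      by (simp add: conn_lincomb_right u w)
    moreover have "rot p (A w p) = lincomb 1 (rot p (D u (\<lambda>q. rot q (w q)) p)) (-1) (lincomb (-1) (D u w p) 0 (D u w p))"
      unfolding A_def rot_rot[OF vector_field_in[OF conn_field[OF u w]], symmetric]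
      by (intro morphism_lincomb[OF bundle_morphism_rot] vector_field_in rot_in conn_field rot_field u w)
    ultimately show ?thesis by (simp add: A_def) (simp add: lincomb_def algebra_simps)
  qed
  \<comment> \<open>This is \<open>i\<close> with J y in place of y, simplified by
    \<open>ii\<close>.\<close>
  have iii: "h p (A x p) (y p) = - h p (x p) (A y p)"
    if x: "vector_field S x" and y: "vector_field S y" and p: "p \<in> points S" for x y p
  proof -
    have "h p (A x p) (rot p (rot p (y p))) = - h p (A x p) (y p)"
      unfolding rot_rot[OF vector_field_in[OF y]]
      by (subst metric_lincomb'[OF p]) (auto intro!: vector_field_in A_field x y)
    moreover have "h p (rot p (x p)) (A (\<lambda>q. rot q (y q)) p) = - h p (x p) (A y p)"
    proof -
      have "h p (rot p (x p)) (A (\<lambda>q. rot q (y q)) p) = - h p (rot p (x p)) (rot p (A y p))"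
        unfolding ii[OF y] by (subst metric_lincomb'[OF p]) (auto intro!: vector_field_in rot_in A_field x y)
      then show ?thesis by (simp add: metric_rot(1) p vector_field_in A_field x y)
    qed
    ultimately show ?thesis using i[OF x rot_field[OF y] p] by simp
  qed
  have "A v p = tzero" for p
  proof (cases "p \<in> points S")
    case p: True
    have Av: "A v p \<in> tangent_space S p" and vT: "v p \<in> tangent_space S p"
      by (intro vector_field_in A_field v)+
    show ?thesis
    proof (cases "v p = tzero")
      case True
      \<comment> \<open>\<open>A\<close> acts on fields, so v p = 0 does not at once give A v p = 0;
        skewness against the field \<open>A v\<close> does.\<close>
      have "h p (A v p) (A v p) = 0"
        using iii[OF v A_field[OF v] p] True metric_tzero[OF p vector_field_in[OF A_field[OF A_field[OF v]]]]
        by simp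
      then show ?thesis by (rule metric_nondegenerate[OF p Av])
    next
      case False
      \<comment> \<open>Taking x = y = v in \<open>iii\<close> and \<open>i\<close> makes
        \<open>A v p\<close> orthogonal to both v p and J v p, which span the tangent space.\<close>
      have 1: "h p (A v p) (v p) = 0"
        using iii[OF v v p] metric_sym[OF p Av vT] by simp
      have 2: "h p (A v p) (rot p (v p)) = 0"
        using i[OF v v p] metric_sym[OF p Av rot_in[OF vT]] by simp
      obtain a b where ab: "A v p = lincomb a (v p) b (rot p (v p))"
        using area_spans[OF p vT rot_in[OF vT] Av area_rot_nonzero[OF p vT False]] by blast
      have "h p (A v p) (A v p) = a * h p (A v p) (v p) + b * h p (A v p) (rot p (v p))"
        using metric_lincomb'[OF p vT rot_in[OF vT] Av, of a b] unfolding ab[symmetric] .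
      then show ?thesis using 1 2 by (intro metric_nondegenerate[OF p Av]) simp
    qed
  next
    case False
    show ?thesis by (rule vector_field_off[OF A_field[OF v] False])
  qed
  then show ?thesis
    by (auto simp: A_def lincomb_def tzero_def fun_eq_iff)
qed

section \<open>From fields to vectors: pointwise form of the curvature\<close>

text \<open>Skewness of \<open>R(u,v)\<close> replaces the usual localization by bump functions: if \<open>e\<close> vanishes at \<open>p\<close>,
  then \<open>h(R(u,v)e, z) = -h(e, R(u,v)z)\<close> does.\<close>

lemma curvature_tensorial:
  assumes u: "vector_field S u" and v: "vector_field S v" and w: "vector_field S w" and z: "vector_field S z"
    and x: "vector_field S x" and y: "vector_field S y"
    and p: "p \<in> points S" and wp: "w p = lincomb a (x p) b (y p)"
  shows "h p (R u v w p) (z p) = a * h p (R u v x p) (z p) + b * h p (R u v y p) (z p)"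
proof -
  define e where "e q = lincomb 1 (w q) (-1) (lincomb a (x q) b (y q))" for q
  have e: "vector_field S e" unfolding e_def by (intro vector_field_lincomb w x y)
  have ep: "e p = tzero" using wp by (simp add: e_def lincomb_def tzero_def)
  have "h p (R u v e p) (z p) = 0"
    using curvature_skew[OF u v e z p] metric_tzero(1)[OF p vector_field_in[OF curvature_field[OF u v z]]]
    unfolding ep by simp
  moreover have "R u v e = (\<lambda>p. lincomb 1 (R u v w p) (-1) (lincomb a (R u v x p) b (R u v y p)))"
    unfolding e_def
    by (simp add: curvature_lincomb_right vector_field_lincomb u v w x y)
  moreover note vector_field_in[OF curvature_field[OF u v w]] vector_field_in[OF curvature_field[OF u v x]]
    vector_field_in[OF curvature_field[OF u v y]] vector_field_in[OF z]
  ultimately show ?thesis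
    by (simp add: metric_lincomb[OF p])
qed

text \<open>Polarised form of the curvature equation, wanted because the deformed metric pairs
  R(u,v) Bv with Bu. Where u and v are independent, w and z are combinations of them, and skewness
  leaves the single coefficient h(R(u,v)v, u) to be prescribed.\<close>

lemma constant_curvature_tensor:
  assumes curv: "\<And>u v p. vector_field S u \<Longrightarrow> vector_field S v \<Longrightarrow> p \<in> points S \<Longrightarrow>
      h p (R u v v p) (u p) = \<kappa> * (h p (u p) (u p) * h p (v p) (v p) - (h p (u p) (v p))\<^sup>2)"
    and u: "vector_field S u" and v: "vector_field S v" and w: "vector_field S w" and z: "vector_field S z"
    and p: "p \<in> points S"
  shows "h p (R u v w p) (z p) = \<kappa> * (h p (v p) (w p) * h p (u p) (z p) - h p (u p) (w p) * h p (v p) (z p))"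
proof -
  \<comment> \<open>The defect of the claim as a function of the fields \<open>u\<close> and
    \<open>v\<close>; it is killed first where they are independent at \<open>p\<close>, and the
    degenerate cases are reduced to that one.\<close>
  define Q where "Q u v = h p (R u v w p) (z p)
    - \<kappa> * (h p (v p) (w p) * h p (u p) (z p) - h p (u p) (w p) * h p (v p) (z p))" for u v
  let ?c = "chart_at S p"
  note c = conjunct1[OF chart_at[OF p]] conjunct2[OF chart_at[OF p]]
  have indep: "Q u v = 0" if u: "vector_field S u" and v: "vector_field S v" and nz: "area ?c (u p) (v p) \<noteq> 0" for u v
  proof -
    note uT = vector_field_in[OF u, of p] and vT = vector_field_in[OF v, of p]
    obtain a b where w_ab: "w p = lincomb a (u p) b (v p)"
      using area_spans[OF p uT vT vector_field_in[OF w] nz] by blast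
    obtain a' b' where z_ab: "z p = lincomb a' (u p) b' (v p)"
      using area_spans[OF p uT vT vector_field_in[OF z] nz] by blast
    let ?G = "h p (u p) (u p) * h p (v p) (v p) - (h p (u p) (v p))\<^sup>2"
    note RuT = vector_field_in[OF curvature_field[OF u v u], of p] and RvT = vector_field_in[OF curvature_field[OF u v v], of p]
    have Rv: "h p (R u v v p) (u p) = \<kappa> * ?G" by (rule curv[OF u v p])
    have Rvv: "h p (R u v v p) (v p) = 0"
      using curvature_skew[OF u v v v p] metric_sym[OF p vT RvT] by simp
    have Ruu: "h p (R u v u p) (u p) = 0"
      using curvature_skew[OF u v u u p] metric_sym[OF p uT RuT] by simp
    have Ruv: "h p (R u v u p) (v p) = - \<kappa> * ?G"
      using curvature_skew[OF u v u v p] metric_sym[OF p uT RvT] Rv by simp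
    have "h p (R u v u p) (z p) = b' * (- \<kappa> * ?G)" "h p (R u v v p) (z p) = a' * (\<kappa> * ?G)"
      unfolding z_ab metric_lincomb'[OF p uT vT RuT] metric_lincomb'[OF p uT vT RvT] Rvv Ruu Ruv Rv
      by simp_all
    then have "h p (R u v w p) (z p) = a * (b' * (- \<kappa> * ?G)) + b * (a' * (\<kappa> * ?G))"
      unfolding curvature_tensorial[OF u v w z u v p w_ab] by simp
    then have "h p (R u v w p) (z p) = \<kappa> * ?G * (b * a' - a * b')"
      by (simp add: algebra_simps)
    then show ?thesis
      unfolding Q_def w_ab z_ab metric_lincomb'[OF p uT vT uT] metric_lincomb'[OF p uT vT vT]
        metric_sym[OF p vT uT]
      by (simp add: algebra_simps power2_eq_square)
  qed
  have swap: "Q u v = - Q v u" if u: "vector_field S u" and v: "vector_field S v" for u v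
  proof -
    note RT = vector_field_in[OF curvature_field[OF v u w], of p]
    have "h p (R u v w p) (z p) = - h p (R v u w p) (z p)"
      unfolding curvature_swap[OF v u w] by (simp add: metric_lincomb[OF p RT RT vector_field_in[OF z]])
    then show ?thesis by (simp add: Q_def algebra_simps)
  qed
  have add: "Q u (\<lambda>q. lincomb 1 (v q) 1 (x q)) = Q u v + Q u x"
    if u: "vector_field S u" and v: "vector_field S v" and x: "vector_field S x" for u v x
  proof -
    note T = vector_field_in[OF curvature_field[OF u v w], of p] vector_field_in[OF curvature_field[OF u x w], of p]
    note vT = vector_field_in[OF v, of p] and xT = vector_field_in[OF x, of p]
      and wT = vector_field_in[OF w, of p] and zT = vector_field_in[OF z, of p]
    show ?thesis
      unfolding Q_def curvature_lincomb_mid[OF u v x w] metric_lincomb[OF p T zT]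
        metric_lincomb[OF p vT xT wT] metric_lincomb[OF p vT xT zT]
      by (simp add: algebra_simps)
  qed
  have nonzero: "Q u v = 0" if u: "vector_field S u" and v: "vector_field S v" and nz: "u p \<noteq> tzero" for u v
  proof (cases "area ?c (u p) (v p) = 0")
    case True
    \<comment> \<open>If v p is parallel to u p, then J u and v + J u are both independent of u at
      \<open>p\<close>; additivity in the second slot subtracts the two defects.\<close>
    let ?x = "\<lambda>q. rot q (u q)"
    have x: "vector_field S ?x" by (rule vector_field_morphism[OF bundle_morphism_rot u])
    have area: "area ?c (u p) (rot p (u p)) \<noteq> 0" by (rule area_rot_nonzero[OF p vector_field_in[OF u] nz])
    have "area ?c (u p) (lincomb 1 (v p) 1 (rot p (u p))) = area ?c (u p) (v p) + area ?c (u p) (rot p (u p))"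
      unfolding lincomb_component by (simp add: algebra_simps)
    then have "area ?c (u p) (lincomb 1 (v p) 1 (rot p (u p))) \<noteq> 0" using True area by simp
    then have "Q u (\<lambda>q. lincomb 1 (v q) 1 (?x q)) = 0" by (rule indep[OF u vector_field_lincomb[OF v x]])
    then show ?thesis using add[OF u v x] indep[OF u x area] by simp
  qed (rule indep[OF u v])
  \<comment> \<open>No bump functions are needed: if every vector field vanishes at \<open>p\<close>, both sides do.\<close>
  have "Q u v = 0"
  proof (cases "\<exists>x. vector_field S x \<and> x p \<noteq> tzero")
    case True
    then obtain x where x: "vector_field S x" "x p \<noteq> tzero" by blast
    show ?thesis
    proof (cases "u p = tzero")
      case True
      \<comment> \<open>\<open>u\<close> is replaced by u + x, which agrees with x at
        \<open>p\<close>. Additivity is available in the second slot, so \<open>swap\<close> moves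
        the sum there.\<close>
      have ux: "vector_field S (\<lambda>q. lincomb 1 (u q) 1 (x q))" by (rule vector_field_lincomb[OF u x(1)])
      have "lincomb 1 (u p) 1 (x p) = x p" by (simp add: True lincomb_def tzero_def)
      then have "Q (\<lambda>q. lincomb 1 (u q) 1 (x q)) v = 0" by (intro nonzero ux v) (simp add: x)
      then have "Q v (\<lambda>q. lincomb 1 (u q) 1 (x q)) = 0" using swap[OF v ux] by simp
      then show ?thesis
        using add[OF v u x(1)] swap[OF u v] swap[OF v x(1)] nonzero[OF x(1) v x(2)] by simp
    qed (rule nonzero[OF u v])
  next
    case False
    then have "z p = tzero" using z by blast
    then show ?thesis
      using p by (simp add: Q_def vector_field_in curvature_field u v w)
  qed
  then show ?thesis by (simp add: Q_def)
qed

end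

text \<open>For the difference A of two such connections, h(A x y, z) is symmetric in x, y by
  torsion-freeness and skew in y, z by compatibility, which forces it to vanish. The lemma
  reconciles the connections of the Codazzi and curvature hypotheses.\<close>

lemma (in riemannian_surface) levi_civita_unique:
  assumes D: "levi_civita S h D" and D': "levi_civita S h D'"
    and u: "vector_field S u" and v: "vector_field S v"
  shows "D u v = D' u v"
proof -
  interpret D: levi_civita_surface S h D by unfold_locales (rule D)
  interpret D': levi_civita_surface S h D' by unfold_locales (rule D')
  define A where "A x y p = lincomb 1 (D x y p) (-1) (D' x y p)" for x y p
  have A_field: "vector_field S (A x y)" if "vector_field S x" "vector_field S y" for x y
    using that unfolding A_def by (intro vector_field_lincomb D.conn_field D'.conn_field)
  have sym: "A x y = A y x" if "vector_field S x" "vector_field S y" for x y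
  proof -
    have "lincomb 1 (D x y p) (-1) (D y x p) c = lincomb 1 (D' x y p) (-1) (D' y x p) c" for p c
      unfolding D.torsion_free[OF that, symmetric, THEN fun_cong] D'.torsion_free[OF that, symmetric, THEN fun_cong] ..
    then have "D x y p c - D' x y p c = D y x p c - D' y x p c" for p c
      by (simp add: lincomb_def algebra_simps)
    then show ?thesis by (simp add: A_def lincomb_def fun_eq_iff)
  qed
  have skew: "h p (A x y p) (z p) = - h p (A x z p) (y p)"
    if x: "vector_field S x" and y: "vector_field S y" and z: "vector_field S z" and p: "p \<in> points S" for x y z p
  proof -
    note T = vector_field_in[OF D.conn_field[OF x y], of p] vector_field_in[OF D'.conn_field[OF x y], of p]
      vector_field_in[OF z, of p]
    note T' = vector_field_in[OF D.conn_field[OF x z], of p] vector_field_in[OF D'.conn_field[OF x z], of p]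
      vector_field_in[OF y, of p]
    show ?thesis
      using D.metric_compatible[OF x y z p] D'.metric_compatible[OF x y z p]
        metric_sym[OF p T'(3) T'(1)] metric_sym[OF p T'(3) T'(2)]
      unfolding A_def metric_lincomb[OF p T] metric_lincomb[OF p T'] by simp
  qed
  have "A u v p = tzero" for p
  proof (cases "p \<in> points S")
    case p: True
    have w: "vector_field S (A u v)" by (rule A_field[OF u v])
    \<comment> \<open>With w = A u v in the last slot, three skewness and three symmetry steps in
      alternation bring the arguments back to their places with a minus sign.\<close>
    have "h p (A u v p) (A u v p) = 0"
      using skew[OF u v w p] skew[OF v u w p] skew[OF w u v p] sym[OF u v] sym[OF v w] sym[OF u w] by simp
    then show ?thesis by (rule metric_nondegenerate[OF p vector_field_in[OF w]])
  next
    case False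
    show ?thesis by (rule vector_field_off[OF A_field[OF u v] False])
  qed
  then show ?thesis by (simp add: A_def lincomb_def tzero_def fun_eq_iff)
qed

section \<open>Deforming a metric by a Codazzi morphism\<close>

text \<open>The inverse \<open>B'\<close> is given as a bundle morphism, which supplies its
  smoothness. The condition on \<open>k\<close> is confined to points of \<open>S\<close> because
  \<open>beta\<close> may be junk elsewhere; off \<open>S\<close> the Codazzi condition is an
  equation between zero vectors.\<close>

locale codazzi_gauge = levi_civita_surface +
  fixes B B' :: "'a morphism" and k :: "'a metric_field"
  assumes B: "bundle_morphism S B" and B': "bundle_morphism S B'"
    and B'B: "\<And>p v. v \<in> tangent_space S p \<Longrightarrow> B' p (B p v) = v"
    and BB': "\<And>p v. v \<in> tangent_space S p \<Longrightarrow> B p (B' p v) = v"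
    and codazzi_B: "\<And>u v p. vector_field S u \<Longrightarrow> vector_field S v \<Longrightarrow>
      lincomb 1 (D u (\<lambda>q. B q (v q)) p) (-1) (D v (\<lambda>q. B q (u q)) p) = B p (lie_bracket S u v p)"
    and k: "\<And>p u v. p \<in> points S \<Longrightarrow> k p u v = h p (B p u) (B p v)"
begin

lemmas B_field = vector_field_morphism[OF B]
lemmas B'_field = vector_field_morphism[OF B']

definition gauge :: "'a connection" where
  "gauge u v = (\<lambda>p. B' p (D u (\<lambda>q. B q (v q)) p))"

lemma gauge_field: "vector_field S u \<Longrightarrow> vector_field S v \<Longrightarrow> vector_field S (gauge u v)"
  unfolding gauge_def by (intro B'_field conn_field B_field)

lemma B_gauge:
  assumes "vector_field S u" "vector_field S v"
  shows "B p (gauge u v p) = D u (\<lambda>q. B q (v q)) p"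
  unfolding gauge_def by (intro BB' vector_field_in conn_field B_field assms)

lemma riemannian_metric_k: "riemannian_metric S k"
  unfolding riemannian_metric_def
proof (intro conjI ballI allI impI)
  fix p u v assume p: "p \<in> points S" and u: "u \<in> tangent_space S p" and v: "v \<in> tangent_space S p"
  note T = morphism_in[OF B]
  show "k p u v = k p v u" unfolding k[OF p] by (rule metric_sym[OF p T[OF u] T[OF v]])
  show "k p (lincomb a u b v) w = a * k p u w + b * k p v w" if w: "w \<in> tangent_space S p" for w a b
    unfolding k[OF p] morphism_lincomb[OF B u v] by (rule metric_lincomb[OF p T[OF u] T[OF v] T[OF w]])
  show "k p u u > 0" if "u \<noteq> tzero"
    unfolding k[OF p]
  proof (rule metric_pos[OF p T[OF u]], rule notI)
    assume "B p u = tzero"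
    then have "B' p (B p u) = tzero" using morphism_tzero[OF B'] by simp
    then show False using B'B[OF u] that by simp
  qed
next
  fix c i j assume c: "c \<in> charts S"
  let ?e = "\<lambda>i x. B (chart_inv c x) (tvec_of S (chart_inv c x) c (axis i 1))"
  have "smooth_on (snd c ` fst c) (\<lambda>x. h (chart_inv c x) (?e i x) (?e j x))"
    by (intro smooth_on_metric riem c morphism_in[OF B] tvec_of_in chart_inv_in morphism_smooth B)
  then show "smooth_on (snd c ` fst c)
      (\<lambda>x. k (chart_inv c x) (tvec_of S (chart_inv c x) c (axis i 1)) (tvec_of S (chart_inv c x) c (axis j 1)))"
    by (rule smooth_on_transform[OF _ chart_image_open[OF c]]) (rule k[OF chart_inv_in_points[OF c]])
qed

lemma affine_connection_gauge: "affine_connection S gauge"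
  unfolding affine_connection_def
proof (intro allI impI, elim conjE, intro conjI)
  fix u v w :: "'a vfield" and f g :: "'a \<Rightarrow> real"
  assume u: "vector_field S u" and v: "vector_field S v" and w: "vector_field S w"
    and f: "smooth_fun S f" and g: "smooth_fun S g"
  note D_in = vector_field_in[OF conn_field[OF _ B_field]]
  show "vector_field S (gauge u v)" by (rule gauge_field[OF u v])
  show "gauge (\<lambda>p. lincomb (f p) (u p) (g p) (v p)) w
      = (\<lambda>p. lincomb (f p) (gauge u w p) (g p) (gauge v w p))"
    unfolding gauge_def conn_lincomb_left_fun[OF u v B_field[OF w] f g]
    by (intro ext morphism_lincomb[OF B'] D_in u v w)
  show "gauge u (\<lambda>p. lincomb 1 (v p) 1 (w p)) = (\<lambda>p. lincomb 1 (gauge u v p) 1 (gauge u w p))"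
    unfolding gauge_def morphism_lincomb[OF B vector_field_in[OF v] vector_field_in[OF w]]
      conn_add_right[OF u B_field[OF v] B_field[OF w]]
    by (intro ext morphism_lincomb[OF B'] D_in u v w)
  have "B p (\<lambda>c. f p *\<^sub>R v p c) = (\<lambda>c. f p *\<^sub>R B p (v p) c)" for p
    using morphism_lincomb[OF B vector_field_in[OF v, of p] vector_field_in[OF v, of p], of "f p" 0]
    by (simp add: lincomb_def)
  then have "gauge u (\<lambda>p c. f p *\<^sub>R v p c) = (\<lambda>p. B' p (D u (\<lambda>p c. f p *\<^sub>R B p (v p) c) p))"
    by (simp add: gauge_def)
  also have "\<dots> = (\<lambda>p. B' p (lincomb (dir_deriv S p (u p) f) (B p (v p)) (f p) (D u (\<lambda>q. B q (v q)) p)))"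
    unfolding conn_scale_right[OF u B_field[OF v] f] ..
  also have "\<dots> = (\<lambda>p. lincomb (dir_deriv S p (u p) f) (B' p (B p (v p))) (f p) (B' p (D u (\<lambda>q. B q (v q)) p)))"
    by (intro ext morphism_lincomb[OF B'] D_in morphism_in[OF B] vector_field_in u v)
  finally show "gauge u (\<lambda>p c. f p *\<^sub>R v p c) = (\<lambda>p. lincomb (dir_deriv S p (u p) f) (v p) (f p) (gauge u v p))"
    unfolding gauge_def B'B[OF vector_field_in[OF v]] .
qed

lemma levi_civita_gauge: "levi_civita S k gauge"
  unfolding levi_civita_def
proof (intro conjI allI impI ballI affine_connection_gauge; (elim conjE)?)
  fix u v :: "'a vfield"
  assume u: "vector_field S u" and v: "vector_field S v"
  have "lincomb 1 (gauge u v p) (-1) (gauge v u p) = lie_bracket S u v p" for p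
  proof -
    have "lincomb 1 (gauge u v p) (-1) (gauge v u p)
        = B' p (lincomb 1 (D u (\<lambda>q. B q (v q)) p) (-1) (D v (\<lambda>q. B q (u q)) p))"
      unfolding gauge_def
      by (intro morphism_lincomb[OF B', symmetric] vector_field_in conn_field B_field u v)
    also have "\<dots> = lie_bracket S u v p"
      unfolding codazzi_B[OF u v] by (intro B'B vector_field_in lie_bracket_field u v)
    finally show ?thesis .
  qed
  then show "(\<lambda>p. lincomb 1 (gauge u v p) (-1) (gauge v u p)) = lie_bracket S u v" by (rule ext)
next
  fix u v w :: "'a vfield" and p
  assume p: "p \<in> points S" and u: "vector_field S u" and v: "vector_field S v" and w: "vector_field S w"
  \<comment> \<open>The two functions are identified on \<open>S\<close> only, hence the congruence
    rule instead of rewriting.\<close>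
  have "dir_deriv S p (u p) (\<lambda>q. h q (B q (v q)) (B q (w q))) = dir_deriv S p (u p) (\<lambda>q. k q (v q) (w q))"
    by (rule dir_deriv_cong[OF p k[symmetric] smooth_fun_metric[OF B_field[OF v] B_field[OF w]]])
  then show "dir_deriv S p (u p) (\<lambda>q. k q (v q) (w q)) = k p (gauge u v p) (w p) + k p (v p) (gauge u w p)"
    unfolding k[OF p] B_gauge[OF u v] B_gauge[OF u w] metric_compatible[OF u B_field[OF v] B_field[OF w] p]
    by simp
qed

text \<open>Each inner \<open>B\<close> cancels the \<open>B'\<close> left by the preceding
  covariant derivative, so iterated derivatives for \<open>gauge\<close> are conjugates of those for
  \<open>D\<close>.\<close>

lemma B_curvature_gauge:
  assumes u: "vector_field S u" and v: "vector_field S v" and w: "vector_field S w"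
  shows "B p (curvature_tensor S gauge u v w p) = R u v (\<lambda>q. B q (w q)) p"
proof -
  have twice: "B p (gauge x (gauge y w) p) = D x (D y (\<lambda>q. B q (w q))) p"
    if x: "vector_field S x" and y: "vector_field S y" for x y
    unfolding B_gauge[OF x gauge_field[OF y w]] B_gauge[OF y w] by simp
  note T = vector_field_in[OF gauge_field[OF u gauge_field[OF v w]], of p]
    vector_field_in[OF gauge_field[OF v gauge_field[OF u w]], of p]
    vector_field_in[OF gauge_field[OF lie_bracket_field[OF u v] w], of p]
  have "curvature_tensor S gauge u v w p = lincomb 1 (lincomb 1 (gauge u (gauge v w) p) (-1) (gauge v (gauge u w) p)) (-1)
    (gauge (lie_bracket S u v) w p)"
    by (simp add: curvature_tensor_def lincomb_def fun_eq_iff)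
  then show ?thesis
    unfolding curvature_eq
    by (simp add: morphism_lincomb[OF B] T lincomb_in twice u v w B_gauge lie_bracket_field)
qed

text \<open>By the polarised curvature equation the numerator is \<kappa> times the mixed Gram
  determinant of (u, v) and (B u, B v). Equal areas allow (u, v) to be replaced by (B u, B v), and
  the result is the Gram determinant of \<open>k\<close>.\<close>

lemma constant_curvature_gauge:
  assumes curv: "\<And>u v p. vector_field S u \<Longrightarrow> vector_field S v \<Longrightarrow> p \<in> points S \<Longrightarrow>
      h p (R u v v p) (u p) = \<kappa> * (h p (u p) (u p) * h p (v p) (v p) - (h p (u p) (v p))\<^sup>2)"
    and det: "\<And>p u v. p \<in> points S \<Longrightarrow> u \<in> tangent_space S p \<Longrightarrow> v \<in> tangent_space S p \<Longrightarrow>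
      area (chart_at S p) (B p u) (B p v) = area (chart_at S p) u v"
  shows "constant_curvature S k \<kappa>"
  unfolding constant_curvature_def
proof (intro exI[of _ gauge] conjI levi_civita_gauge allI impI ballI; elim conjE)
  fix u v p assume u: "vector_field S u" and v: "vector_field S v" and p: "p \<in> points S"
  note c = conjunct1[OF chart_at[OF p]] conjunct2[OF chart_at[OF p]]
  note uT = vector_field_in[OF u, of p] and vT = vector_field_in[OF v, of p]
  note BuT = morphism_in[OF B uT] and BvT = morphism_in[OF B vT]
  have "k p (curvature_tensor S gauge u v v p) (u p) = h p (R u v (\<lambda>q. B q (v q)) p) (B p (u p))"
    unfolding k[OF p] B_curvature_gauge[OF u v v] ..
  also have "\<dots> = \<kappa> * (h p (v p) (B p (v p)) * h p (u p) (B p (u p)) - h p (u p) (B p (v p)) * h p (v p) (B p (u p)))"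
    by (rule constant_curvature_tensor[OF curv u v B_field[OF v] B_field[OF u] p])
  also have "h p (v p) (B p (v p)) * h p (u p) (B p (u p)) - h p (u p) (B p (v p)) * h p (v p) (B p (u p))
     = metric_det (chart_at S p) p * area (chart_at S p) (u p) (v p) * area (chart_at S p) (B p (u p)) (B p (v p))"
    using metric_cauchy_binet[OF c uT vT BuT BvT] by (simp add: mult.commute)
  also have "\<dots> = metric_det (chart_at S p) p * area (chart_at S p) (B p (u p)) (B p (v p)) * area (chart_at S p) (B p (u p)) (B p (v p))"
    unfolding det[OF p uT vT] ..
  also have "\<dots> = k p (u p) (u p) * k p (v p) (v p) - (k p (u p) (v p))\<^sup>2"
    using metric_cauchy_binet[OF c BuT BvT BuT BvT] metric_sym[OF p BuT BvT]
    by (simp add: k[OF p] power2_eq_square)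
  finally show "k p (curvature_tensor S gauge u v v p) (u p) = \<kappa> * (k p (u p) (u p) * k p (v p) (v p) - (k p (u p) (v p))\<^sup>2)" .
qed

end

section \<open>Application to the family of morphisms indexed by \<theta>\<close>

theorem proposition1p7:
  fixes S :: "'a surface" and g :: nat
    and h hstar :: "'a metric_field" and b :: "'a morphism"
  assumes "closed_oriented_surface S" and "has_genus S g" and "g \<ge> 2"
    and "hyperbolic_metric S h" and "hyperbolic_metric S hstar"
    and "associated_morphism S h hstar b"
  shows "\<forall>\<theta>::real. hyperbolic_metric S (metric_via h (beta S h b \<theta>))"
proof
  fix \<theta> :: real
  have b: "bundle_morphism S b"
    and self_adjoint: "\<And>p u v. p \<in> points S \<Longrightarrow> u \<in> tangent_space S p \<Longrightarrow> v \<in> tangent_space S p \<Longrightarrow>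
      h p (b p u) v = h p u (b p v)"
    and det: "\<And>p. p \<in> points S \<Longrightarrow> morphism_det S b p = 1"
    and "codazzi S h b"
    using assms(6) unfolding associated_morphism_def by blast+
  then obtain D where D: "levi_civita S h D"
    and codazzi: "\<And>u v p c. vector_field S u \<Longrightarrow> vector_field S v \<Longrightarrow> p \<in> points S \<Longrightarrow>
      D u (\<lambda>q. b q (v q)) p c - D v (\<lambda>q. b q (u q)) p c - b p (lie_bracket S u v p) c = 0"
    unfolding codazzi_def by blast
  \<comment> \<open>The curvature hypothesis brings its own connection; uniqueness will transfer the
    equation to the \<open>D\<close> of the Codazzi hypothesis.\<close>
  obtain D' where D': "levi_civita S h D'"
    and curv': "\<And>u v p. vector_field S u \<Longrightarrow> vector_field S v \<Longrightarrow> p \<in> points S \<Longrightarrow>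
      h p (curvature_tensor S D' u v v p) (u p) = -1 * (h p (u p) (u p) * h p (v p) (v p) - (h p (u p) (v p))\<^sup>2)"
    using assms(4) unfolding hyperbolic_metric_def constant_curvature_def by blast
  interpret levi_civita_surface S h D
    using assms(1,4) D by unfold_locales (simp_all add: hyperbolic_metric_def)
  have curv: "h p (R u v v p) (u p) = -1 * (h p (u p) (u p) * h p (v p) (v p) - (h p (u p) (v p))\<^sup>2)"
    if u: "vector_field S u" and v: "vector_field S v" and p: "p \<in> points S" for u v p
  proof -
    note unique = levi_civita_unique[OF D D']
    have "R u v v p = curvature_tensor S D' u v v p"
      unfolding curvature_tensor_def
      by (simp add: unique[symmetric] u v conn_field lie_bracket_field)
    then show ?thesis using curv'[OF u v p] by simp
  qed
  \<comment> \<open>Built with \<open>rot\<close>, so that \<open>K\<close> is a bundle morphism off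
    \<open>S\<close> as well; on \<open>S\<close> it is the J b occurring in
    \<open>beta\<close>.\<close>
  define K where "K p v = rot p (b p v)" for p v
  have K: "bundle_morphism S K"
    unfolding K_def by (rule bundle_morphism_comp[OF bundle_morphism_rot b])
  note K_field = vector_field_morphism[OF K]
  have K_coords: "\<exists>\<alpha> \<beta> \<gamma>. \<alpha> * \<alpha> + \<beta> * \<gamma> = -1 \<and>
      (\<forall>u\<in>tangent_space S p. K p u (chart_at S p) $ 1 = \<alpha> * u (chart_at S p) $ 1 + \<beta> * u (chart_at S p) $ 2 \<and>
        K p u (chart_at S p) $ 2 = \<gamma> * u (chart_at S p) $ 1 - \<alpha> * u (chart_at S p) $ 2)"
    if p: "p \<in> points S" for p
    using rot_coords_self_adjoint[OF b p self_adjoint[OF p] det[OF p]] unfolding K_def by metis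
  have KK: "K p (K p v) = lincomb (-1) v 0 v" if v: "v \<in> tangent_space S p" for p v
  proof (cases "p \<in> points S")
    case True
    let ?c = "chart_at S p"
    note c = conjunct1[OF chart_at[OF True]] conjunct2[OF chart_at[OF True]]
    obtain \<alpha> \<beta> \<gamma> where sq: "\<alpha> * \<alpha> + \<beta> * \<gamma> = -1"
      and Kc: "\<And>u. u \<in> tangent_space S p \<Longrightarrow> K p u ?c $ 1 = \<alpha> * u ?c $ 1 + \<beta> * u ?c $ 2"
        "\<And>u. u \<in> tangent_space S p \<Longrightarrow> K p u ?c $ 2 = \<gamma> * u ?c $ 1 - \<alpha> * u ?c $ 2"
      using K_coords[OF True] by blast
    have "K p (K p v) ?c $ 1 = (\<alpha> * \<alpha> + \<beta> * \<gamma>) * v ?c $ 1" "K p (K p v) ?c $ 2 = (\<alpha> * \<alpha> + \<beta> * \<gamma>) * v ?c $ 2"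
      unfolding Kc[OF morphism_in[OF K v]] Kc[OF v] by (simp_all add: algebra_simps)
    then have "K p (K p v) ?c = lincomb (-1) v 0 v ?c"
      unfolding sq by (simp add: vec_eq_iff forall_2 lincomb_def)
    then show ?thesis by (rule tangent_eqI[OF morphism_in[OF K morphism_in[OF K v]] lincomb_in[OF v v] c])
  next
    case False
    then have "v = tzero" using v tangent_space_off by blast
    then show ?thesis using morphism_tzero[OF K, of p] by (simp add: lincomb_def tzero_def)
  qed
  have codazzi_K: "lincomb 1 (D u (\<lambda>q. K q (v q)) p) (-1) (D v (\<lambda>q. K q (u q)) p) = K p (lie_bracket S u v p)"
    if u: "vector_field S u" and v: "vector_field S v" for u v p
  proof (cases "p \<in> points S")
    case True
    note b_field = vector_field_morphism[OF b]
    have "lincomb 1 (D u (\<lambda>q. b q (v q)) p) (-1) (D v (\<lambda>q. b q (u q)) p) = b p (lie_bracket S u v p)"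
      using codazzi[OF u v True] by (simp add: lincomb_def fun_eq_iff)
    \<comment> \<open>\<open>J\<close> is parallel and therefore comes out of both covariant
      derivatives.\<close>
    moreover have "lincomb 1 (D u (\<lambda>q. K q (v q)) p) (-1) (D v (\<lambda>q. K q (u q)) p)
      = rot p (lincomb 1 (D u (\<lambda>q. b q (v q)) p) (-1) (D v (\<lambda>q. b q (u q)) p))"
      unfolding K_def rot_parallel[OF u b_field[OF v]] rot_parallel[OF v b_field[OF u]]
      by (intro morphism_lincomb[OF bundle_morphism_rot, symmetric] vector_field_in conn_field b_field u v)
    ultimately show ?thesis by (simp add: K_def)
  next
    case False
    have lhs: "vector_field S (\<lambda>p. lincomb 1 (D u (\<lambda>q. K q (v q)) p) (-1) (D v (\<lambda>q. K q (u q)) p))"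
      by (intro vector_field_lincomb conn_field K_field u v)
    show ?thesis
      using vector_field_off[OF lhs False] vector_field_off[OF K_field[OF lie_bracket_field[OF u v]] False] by simp
  qed
  \<comment> \<open>The coefficient of \<open>K\<close> is a parameter, so that one computation with
    s and -s serves both one-sided inverses.\<close>
  define B where "B s = (\<lambda>p v. lincomb (cos (\<theta> / 2)) v s (K p v))" for s
  have B: "bundle_morphism S (B s)" for s
    unfolding B_def by (rule bundle_morphism_lincomb[OF bundle_morphism_ident K])
  have inverse: "B (-s) p (B s p v) = v"
    if v: "v \<in> tangent_space S p" and s: "s\<^sup>2 = (sin (\<theta> / 2))\<^sup>2" for s p v
  proof -
    have one: "cos (\<theta> / 2) * cos (\<theta> / 2) + s * s = 1"
      using s sin_cos_squared_add2[of "\<theta> / 2"] by (simp add: power2_eq_square)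
    \<comment> \<open>With c = cos (\<theta>/2): (c E - s K)(c E + s K) = c^2 E - s^2 K^2, and K^2 =
      -E.\<close>
    have "B (-s) p (B s p v) c = (cos (\<theta> / 2) * cos (\<theta> / 2) + s * s) *\<^sub>R v c" for c
      unfolding B_def morphism_lincomb[OF K v morphism_in[OF K v]] KK[OF v]
      by (simp add: lincomb_def algebra_simps)
    then show ?thesis unfolding one by (simp add: fun_eq_iff)
  qed
  interpret codazzi_gauge S h D "B (sin (\<theta> / 2))" "B (- sin (\<theta> / 2))" "metric_via h (beta S h b \<theta>)"
  proof
    show "B (- sin (\<theta> / 2)) p (B (sin (\<theta> / 2)) p v) = v" if "v \<in> tangent_space S p" for p v
      using inverse[OF that] by simp
    show "B (sin (\<theta> / 2)) p (B (- sin (\<theta> / 2)) p v) = v" if "v \<in> tangent_space S p" for p v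
      using inverse[OF that, of "- sin (\<theta> / 2)"] by simp
    \<comment> \<open>The constant coefficients pass through \<open>D\<close>: the E part is
      torsion-freeness and the K part is \<open>codazzi_K\<close>.\<close>
    show "lincomb 1 (D u (\<lambda>q. B (sin (\<theta> / 2)) q (v q)) p) (-1) (D v (\<lambda>q. B (sin (\<theta> / 2)) q (u q)) p)
        = B (sin (\<theta> / 2)) p (lie_bracket S u v p)"
      if u: "vector_field S u" and v: "vector_field S v" for u v p
      unfolding B_def conn_lincomb_right[OF u v K_field[OF v]] conn_lincomb_right[OF v u K_field[OF u]]
        codazzi_K[OF u v, symmetric] unfolding torsion_free[OF u v]
      by (simp add: lincomb_def algebra_simps)
    show "metric_via h (beta S h b \<theta>) p u v = h p (B (sin (\<theta> / 2)) p u) (B (sin (\<theta> / 2)) p v)"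
      if "p \<in> points S" for p u v
      using that by (simp add: metric_via_def beta_def B_def K_def rot_def)
  qed (rule B)+
  have "constant_curvature S (metric_via h (beta S h b \<theta>)) (-1)"
  proof (rule constant_curvature_gauge[OF curv])
    fix p u v assume p: "p \<in> points S" and u: "u \<in> tangent_space S p" and v: "v \<in> tangent_space S p"
    let ?c = "chart_at S p"
    let ?C = "cos (\<theta> / 2)" and ?s = "sin (\<theta> / 2)"
    obtain \<alpha> \<beta> \<gamma> where sq: "\<alpha> * \<alpha> + \<beta> * \<gamma> = -1"
      and Kc: "\<And>u. u \<in> tangent_space S p \<Longrightarrow> K p u ?c $ 1 = \<alpha> * u ?c $ 1 + \<beta> * u ?c $ 2"
        "\<And>u. u \<in> tangent_space S p \<Longrightarrow> K p u ?c $ 2 = \<gamma> * u ?c $ 1 - \<alpha> * u ?c $ 2"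
      using K_coords[OF p] by blast
    \<comment> \<open>The matrix has rows (c + s \<alpha>, s \<beta>) and (s \<gamma>, c - s
      \<alpha>); as \<open>K\<close> is trace-free, its determinant has no term linear in s.\<close>
    have "area ?c (B ?s p u) (B ?s p v) = (?C * ?C - ?s * ?s * (\<alpha> * \<alpha> + \<beta> * \<gamma>)) * area ?c u v"
      unfolding B_def lincomb_component Kc[OF u] Kc[OF v] by (simp add: algebra_simps)
    then show "area ?c (B ?s p u) (B ?s p v) = area ?c u v"
      unfolding sq using sin_cos_squared_add2[of "\<theta> / 2"] by (simp add: power2_eq_square)
  qed
  then show "hyperbolic_metric S (metric_via h (beta S h b \<theta>))"
    using riemannian_metric_k by (simp add: hyperbolic_metric_def)
qed

end
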